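(* Let $m\ge 2$, let $\Omega_m=\{0,\dots,m-1\}^{\mathbb N}$ with its product Borel structure, and let $H$ be a complex Hilbert space. (i) If $E$ is a POVM on $\Omega_m$ with values in $B(H)$, write $E_w=E([w])$ and $H_w=\overline{\operatorname{ran}}(E_w^{1/2})$ for each finite word $w$ in the alphabet $\{0,\dots,m-1\}$. Then, for every $w$, there are unique positive contractions $A_w^{(0)},\dots,A_w^{(m-1)}\in B(H_w)$ such that $$\sum_{j=0}^{m-1}A_w^{(j)}=I_{H_w}\qquad\text{and}\qquad E_{wj}=E_w^{1/2}A_w^{(j)}E_w^{1/2}\quad(0\le j\le m-1).$$ (ii) Conversely, suppose that $E_\varnothing=I$ and that operators $E_w$, indexed by the finite words $w$, are defined recursively by positive contractions $A_w^{(j)}\in B(H_w)$, $H_w=\overline{\operatorname{ran}}(E_w^{1/2})$, satisfying $$\sum_{j=0}^{m-1}A_w^{(j)}=I_{H_w},\qquad E_{wj}=E_w^{1/2}A_w^{(j)}E_w^{1/2}\quad(0\le j\le m-1)$$ for every finite word $w$. Then there is a unique POVM $E$ on $\Omega_m$ with values in $B(H)$ such that $E([w])=E_w$ for every finite word $w$.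
   Context: For a finite word $w=w_1\cdots w_n$ in $\{0,\dots,m-1\}$, $[w]=\{x\in\Omega_m:x_1=w_1,\dots,x_n=w_n\}$; the empty word is $\varnothing$, and $[\varnothing]=\Omega_m$; $wj$ is $w$ with the letter $j$ appended. $B(H)_+$ is the set of bounded positive operators on $H$. A POVM on $\Omega_m$ with values in $B(H)$ is a map $E:\mathcal B(\Omega_m)\to B(H)_+$ on the Borel $\sigma$-algebra that is countably additive in the weak operator topology and satisfies $E(\Omega_m)=I$. A positive contraction on $H_w$ is $A\in B(H_w)$ with $0\le A\le I_{H_w}$. In products such as $E_w^{1/2}AE_w^{1/2}$, an operator $A$ on $H_w$ is extended by zero on $H_w^\perp$. *)

theory Defs
  imports "HOL-Analysis.Analysis"
begin

section \<open>Complex Hilbert spaces\<close>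

text \<open>
  The norm, the metric and the real scalar multiplication are those of \<^class>\<open>real_inner\<close>; the
  axioms make the real inner product the real part of the complex one, so that
  \<open>norm x ^ 2 = cinner x x\<close>. The form \<open>cinner\<close> is linear in its second argument.
  The space may be zero, and need not be separable.
\<close>

class complex_vector = real_vector +
  fixes scaleC :: "complex \<Rightarrow> 'a \<Rightarrow> 'a"  (infixr \<open>*\<^sub>C\<close> 75)
  assumes scaleC_add_right: "a *\<^sub>C (x + y) = a *\<^sub>C x + a *\<^sub>C y"
    and scaleC_add_left: "(a + b) *\<^sub>C x = a *\<^sub>C x + b *\<^sub>C x"
    and scaleC_scaleC: "a *\<^sub>C (b *\<^sub>C x) = (a * b) *\<^sub>C x"
    and scaleC_one: "1 *\<^sub>C x = x"
    and scaleR_scaleC: "r *\<^sub>R x = complex_of_real r *\<^sub>C x"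

class complex_inner = complex_vector + real_inner +
  fixes cinner :: "'a \<Rightarrow> 'a \<Rightarrow> complex"
  assumes cinner_commute: "cinner x y = cnj (cinner y x)"
    and cinner_add_right: "cinner x (y + z) = cinner x y + cinner x z"
    and cinner_scaleC_right: "cinner x (a *\<^sub>C y) = a * cinner x y"
    and inner_eq_Re_cinner: "inner x y = Re (cinner x y)"

class complex_hilbert = complex_inner + complete_space

instantiation complex :: complex_hilbert
begin

definition scaleC_complex :: "complex \<Rightarrow> complex \<Rightarrow> complex"
  where "scaleC_complex a x = a * x"

definition cinner_complex :: "complex \<Rightarrow> complex \<Rightarrow> complex"
  where "cinner_complex x y = cnj x * y"

instance
  by standard
    (auto simp: scaleC_complex_def cinner_complex_def inner_complex_def scaleR_conv_of_real
      algebra_simps)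

end


section \<open>Operators on a closed subspace\<close>

text \<open>
  \<open>bounded_ops S\<close> is \<open>B(S)\<close> for a subspace \<open>S\<close>. Its elements are functions with domain \<open>S\<close>, that
  is, they are \<^const>\<open>undefined\<close> outside \<open>S\<close>, so that equality in HOL is equality of operators
  on \<open>S\<close>.
\<close>

definition bounded_ops :: "'a::complex_hilbert set \<Rightarrow> ('a \<Rightarrow> 'a) set" where
  "bounded_ops S = {A \<in> S \<rightarrow>\<^sub>E S.
     (\<forall>x\<in>S. \<forall>y\<in>S. A (x + y) = A x + A y) \<and>
     (\<forall>c. \<forall>x\<in>S. A (c *\<^sub>C x) = c *\<^sub>C A x) \<and>
     (\<exists>K. \<forall>x\<in>S. norm (A x) \<le> K * norm x)}"

definition positive_ops :: "'a::complex_hilbert set \<Rightarrow> ('a \<Rightarrow> 'a) set" where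
  "positive_ops S = {A \<in> bounded_ops S. \<forall>x\<in>S. cinner x (A x) \<in> \<real>\<^sub>\<ge>\<^sub>0}"

definition positive_contractions :: "'a::complex_hilbert set \<Rightarrow> ('a \<Rightarrow> 'a) set" where
  "positive_contractions S =
     {A \<in> positive_ops S. restrict (\<lambda>x. x - A x) S \<in> positive_ops S}"

definition op_sqrt :: "('a::complex_hilbert \<Rightarrow> 'a) \<Rightarrow> 'a \<Rightarrow> 'a" where
  "op_sqrt T = (THE R. R \<in> positive_ops UNIV \<and> R \<circ> R = T)"

definition support_space :: "('a::complex_hilbert \<Rightarrow> 'a) \<Rightarrow> 'a set" where
  "support_space T = closure (range (op_sqrt T))"

text \<open>For a closed subspace \<open>S\<close>, \<open>orth_proj S\<close> is the orthogonal projection of the whole space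
  onto \<open>S\<close>, so \<open>zero_ext S A\<close> agrees with \<open>A\<close> on \<open>S\<close> and vanishes on the orthogonal complement.\<close>

definition orth_proj :: "'a::complex_hilbert set \<Rightarrow> 'a \<Rightarrow> 'a" where
  "orth_proj S x = (THE p. p \<in> S \<and> (\<forall>y\<in>S. cinner y (x - p) = 0))"

definition zero_ext :: "'a::complex_hilbert set \<Rightarrow> ('a \<Rightarrow> 'a) \<Rightarrow> 'a \<Rightarrow> 'a" where
  "zero_ext S A = A \<circ> orth_proj S"

lemma bounded_ops_UNIV:
  "bounded_ops UNIV = {T. bounded_linear T \<and> (\<forall>c x. T (c *\<^sub>C x) = c *\<^sub>C T x)}"
proof (intro set_eqI iffI)
  fix T :: "'a \<Rightarrow> 'a"
  assume "T \<in> bounded_ops UNIV"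
  then obtain K where T: "\<And>x y. T (x + y) = T x + T y" "\<And>c x. T (c *\<^sub>C x) = c *\<^sub>C T x"
      "\<And>x. norm (T x) \<le> K * norm x"
    unfolding bounded_ops_def by auto
  have "bounded_linear T"
    by (rule bounded_linear_intro[where K = K])
      (simp_all add: T(1,2) scaleR_scaleC, metis T(3) mult.commute)
  then show "T \<in> {T. bounded_linear T \<and> (\<forall>c x. T (c *\<^sub>C x) = c *\<^sub>C T x)}"
    using T(2) by simp
next
  fix T :: "'a \<Rightarrow> 'a"
  assume *: "T \<in> {T. bounded_linear T \<and> (\<forall>c x. T (c *\<^sub>C x) = c *\<^sub>C T x)}"
  then interpret bounded_linear T by simp
  show "T \<in> bounded_ops UNIV"
    using * bounded add by (auto simp: bounded_ops_def mult.commute)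
qed


section \<open>Sequences over a finite alphabet and POVMs\<close>

text \<open>Sequences are indexed from \<open>0\<close>: the letter \<open>x\<^sub>i\<^sub>+\<^sub>1\<close> is \<open>x i\<close>. Finite words over
  the alphabet are the elements of \<open>lists {..<m}\<close>.\<close>

definition Omega :: "nat \<Rightarrow> (nat \<Rightarrow> nat) measure" where
  "Omega m = (\<Pi>\<^sub>M i\<in>UNIV. count_space {..<m})"

definition cylinder :: "nat \<Rightarrow> nat list \<Rightarrow> (nat \<Rightarrow> nat) set" where
  "cylinder m w = {x \<in> space (Omega m). \<forall>i<length w. x i = w ! i}"

lemma space_Omega: "space (Omega m) = UNIV \<rightarrow> {..<m}"
  by (auto simp: Omega_def space_PiM)

text \<open>The product \<open>\<sigma>\<close>-algebra is the Borel \<open>\<sigma>\<close>-algebra of the product topology.\<close>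

lemma sets_Omega_eq_borel: "sets (Omega m) = sets (restrict_space borel (UNIV \<rightarrow> {..<m}))"
proof
  show "sets (Omega m) \<subseteq> sets (restrict_space borel (UNIV \<rightarrow> {..<m}))"
    unfolding Omega_def
  proof (rule sets_PiM_in_sets)
    show "space (restrict_space borel (UNIV \<rightarrow> {..<m})) =
        (\<Pi>\<^sub>E i\<in>UNIV. space (count_space {..<m}))"
      by (auto simp: space_restrict_space)
    fix i :: nat and A
    have "open {x :: nat \<Rightarrow> nat. x i \<in> A}"
      using open_vimage[OF open_discrete[of A] continuous_on_product_coordinates[of i]]
      by (simp add: vimage_def)
    then show "{x \<in> space (restrict_space borel (UNIV \<rightarrow> {..<m})). x i \<in> A}
        \<in> sets (restrict_space borel (UNIV \<rightarrow> {..<m}))"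
      by (auto simp: sets_restrict_space space_restrict_space image_iff
          intro!: bexI[of _ "{x. x i \<in> A}"])
  qed
  have "(\<lambda>x. x) \<in> Omega m \<rightarrow>\<^sub>M (\<Pi>\<^sub>M i\<in>UNIV. (borel :: nat measure))"
  proof (rule measurable_PiM_single')
    fix i :: nat
    have "(\<lambda>x. x i) \<in> Omega m \<rightarrow>\<^sub>M count_space {..<m}"
      by (simp add: Omega_def)
    then show "(\<lambda>x. x i) \<in> Omega m \<rightarrow>\<^sub>M borel"
      by (rule measurable_compose) simp
  qed auto
  then have "(\<lambda>x. x) \<in> Omega m \<rightarrow>\<^sub>M borel"
    using sets_PiM_equal_borel measurable_cong_sets by blast
  from measurable_sets[OF this]
  show "sets (restrict_space borel (UNIV \<rightarrow> {..<m})) \<subseteq> sets (Omega m)"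
    by (auto simp: sets_restrict_space space_Omega Int_commute)
qed

text \<open>A POVM is a function with domain \<open>sets M\<close>, that is, \<^const>\<open>undefined\<close> on non-measurable
  sets. The sum in the countable additivity converges in the weak operator topology.\<close>

definition povm :: "'b measure \<Rightarrow> ('b set \<Rightarrow> 'a::complex_hilbert \<Rightarrow> 'a) \<Rightarrow> bool" where
  "povm M E \<longleftrightarrow>
     E \<in> sets M \<rightarrow>\<^sub>E positive_ops UNIV \<and>
     E (space M) = id \<and>
     (\<forall>B :: nat \<Rightarrow> 'b set. range B \<subseteq> sets M \<longrightarrow> disjoint_family B \<longrightarrow>
        (\<forall>x y. (\<lambda>n. cinner x (E (B n) y)) sums cinner x (E (\<Union>n. B n) y)))"

end

theory Submission
  imports Defs
begin

text \<open>
  Both directions rest on one fact about a positive operator \<open>T\<close> on a complex Hilbert space with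
  support \<open>H = closure (range (op_sqrt T))\<close>: if \<open>0 \<le> D \<le> T\<close>, then
  \<open>D = op_sqrt T \<circ> A \<circ> op_sqrt T\<close> for exactly one positive contraction \<open>A\<close> of \<open>H\<close>. For existence,
  \<open>norm (op_sqrt D x) \<le> norm (op_sqrt T x)\<close>, so Douglas factorization gives a contraction \<open>C\<close>
  into \<open>H\<close> with \<open>op_sqrt D = op_sqrt T \<circ> C\<close>, and \<open>A\<close> is \<open>C\<close> composed with its adjoint.
  For uniqueness, \<open>op_sqrt T\<close> is injective on \<open>H\<close> and has dense range there. The same injectivity
  turns \<open>(\<Sum>j. D j) = T\<close> into \<open>(\<Sum>j. A j) = I\<close> on \<open>H\<close>. Applied to \<open>T = E\<^sub>w\<close> and
  \<open>D j = E\<^sub>w\<^sub>j\<close> this is the first half (\<open>operator_derivatives_unique_existence\<close>).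

  Conversely, operators \<open>E\<^sub>w\<close> obtained from such contractions are positive and satisfy
  \<open>(\<Sum>j. E\<^sub>w\<^sub>j) = E\<^sub>w\<close>. Hence, for each vector \<open>x\<close>, the numbers \<open>inner x (E\<^sub>w x)\<close> are the cylinder
  masses of a finite measure \<open>\<mu>\<^sub>x\<close> on the sequence space (\<open>measure_with_cylinder_masses\<close>).
  Cylinders form an intersection-stable generator, so every linear identity between these measures
  that holds on cylinders holds on all measurable sets. In this way \<open>x \<mapsto> \<mu>\<^sub>x B\<close> is a positive
  quadratic form bounded by \<open>norm x ^ 2\<close>, and the Riesz representation theorem produces the
  operator \<open>E B\<close> (\<open>povm_with_cylinder_values_exists\<close>). Uniqueness of the POVM is the same
  generator argument.

  Existence and uniqueness of the positive square root come from the binomial series of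
  \<open>sqrt (1 - t)\<close>, whose coefficients are absolutely summable. Projections, adjoints, Douglas
  factorization and the Riesz theorem itself come from a single minimization argument on a
  not necessarily closed subspace (\<open>riesz_on_subspace\<close>).

  The proofs work mostly with the real inner product, which together with multiplication by \<open>\<i>\<close>
  determines the complex one.
\<close>

section \<open>Orthogonality and the Riesz representation on a dense subspace\<close>

instance complex_hilbert \<subseteq> banach ..

text \<open>Here \<open>L\<close> is an arbitrary set with \<open>u\<close> in its closure; in the applications it is a dense subset
  of a closed subspace that contains \<open>u\<close>.\<close>

lemma norm_le_if_inner_le_on_dense:
  fixes u :: "'a::real_inner"
  assumes u: "u \<in> closure L" and le: "\<And>x. x \<in> L \<Longrightarrow> inner u x \<le> K * norm x"
    and K: "0 \<le> K"
  shows "norm u \<le> K"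
proof -
  have "closed {x. inner u x \<le> K * norm x}"
    by (intro closed_Collect_le continuous_intros)
  then have "closure L \<subseteq> {x. inner u x \<le> K * norm x}"
    using le by (intro closure_minimal) auto
  with u have "norm u * norm u \<le> K * norm u"
    by (auto simp: dot_square_norm power2_eq_square)
  then show ?thesis
    using K by (cases "u = 0") auto
qed

lemma eq_0_if_inner_0_on_dense:
  fixes u :: "'a::real_inner"
  assumes "u \<in> closure L" and "\<And>x. x \<in> L \<Longrightarrow> inner u x = 0"
  shows "u = 0"
  using norm_le_if_inner_le_on_dense[of u L 0] assms by auto

text \<open>The Riesz representation theorem on a subspace that need not be closed: the representing
  vector is the limit of a sequence minimizing \<open>norm x ^ 2 - 2 * f x\<close>. For \<open>f = inner x\<close> it gives
  the projection onto the closure of the subspace.\<close>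

lemma riesz_on_subspace:
  fixes f :: "'a::{real_inner,complete_space} \<Rightarrow> real"
  assumes L: "subspace L"
    and add: "\<And>x y. x \<in> L \<Longrightarrow> y \<in> L \<Longrightarrow> f (x + y) = f x + f y"
    and scale: "\<And>c x. x \<in> L \<Longrightarrow> f (c *\<^sub>R x) = c * f x"
    and bound: "\<And>x. x \<in> L \<Longrightarrow> \<bar>f x\<bar> \<le> K * norm x"
  obtains u where "u \<in> closure L" "\<And>x. x \<in> L \<Longrightarrow> inner u x = f x"
proof -
  define \<phi> where "\<phi> x = (norm x)\<^sup>2 - 2 * f x" for x
  define d where "d = Inf (\<phi> ` L)"
  have L0: "0 \<in> L" using L by (rule subspace_0)
  have below: "- K\<^sup>2 \<le> \<phi> x" if "x \<in> L" for x
  proof -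
    have "0 \<le> (norm x - K)\<^sup>2" by simp
    then show ?thesis
      using bound[OF that] by (simp add: \<phi>_def power2_eq_square algebra_simps)
  qed
  then have bdd: "bdd_below (\<phi> ` L)" by (auto intro!: bdd_belowI)
  have d_le: "d \<le> \<phi> x" if "x \<in> L" for x
    unfolding d_def using bdd that by (intro cInf_lower) auto
  have "\<exists>x\<in>L. \<phi> x < d + 1 / real (Suc n)" for n
  proof -
    have "\<exists>y\<in>\<phi> ` L. y < d + 1 / real (Suc n)"
      unfolding d_def using L0 by (intro cInf_lessD) auto
    then show ?thesis by auto
  qed
  then obtain X where XL: "\<And>n. X n \<in> L" and Xd: "\<And>n. \<phi> (X n) < d + 1 / real (Suc n)"
    by metis
  \<comment> \<open>the parallelogram law: near-minimizers are close to each other\<close>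
  have near: "(dist (X i) (X j))\<^sup>2 \<le> 2 * (1 / real (Suc i) + 1 / real (Suc j))" for i j
  proof -
    let ?x = "X i" and ?y = "X j"
    have sum: "?x + ?y \<in> L" using L XL by (intro subspace_add)
    have mid: "(1/2) *\<^sub>R (?x + ?y) \<in> L" using L sum by (rule subspace_scale)
    have "f ((1/2) *\<^sub>R (?x + ?y)) = (f ?x + f ?y) / 2"
      by (simp only: scale[OF sum] add[OF XL XL])
    then have "\<phi> ?x + \<phi> ?y - 2 * \<phi> ((1/2) *\<^sub>R (?x + ?y)) = (norm (?x - ?y))\<^sup>2 / 2"
      unfolding \<phi>_def power2_norm_eq_inner
      by (simp add: inner_add_left inner_add_right inner_diff_left inner_diff_right inner_commute
          field_simps)
    then show ?thesis
      using d_le[OF mid] Xd[of i] Xd[of j] by (simp add: dist_norm)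
  qed
  have "Cauchy X"
  proof (rule metric_CauchyI)
    fix e :: real assume "0 < e"
    then obtain N where N: "4 / e\<^sup>2 < real N" using reals_Archimedean2 by blast
    have "dist (X i) (X j) < e" if "N \<le> i" "N \<le> j" for i j
    proof -
      have N0: "0 < real N" using N \<open>0 < e\<close> by (smt (verit) divide_pos_pos zero_less_power)
      have "1 / real (Suc i) \<le> 1 / real N" "1 / real (Suc j) \<le> 1 / real N"
        using that N0 by (auto intro!: divide_left_mono)
      with near[of i j] have "(dist (X i) (X j))\<^sup>2 \<le> 4 / real N" by simp
      also have "\<dots> < e\<^sup>2" using N N0 \<open>0 < e\<close> by (simp add: field_simps)
      finally show ?thesis using \<open>0 < e\<close> by (simp add: power_less_imp_less_base)
    qed
    then show "\<exists>M. \<forall>m\<ge>M. \<forall>n\<ge>M. dist (X m) (X n) < e" by blast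
  qed
  then obtain u where u: "X \<longlonglongrightarrow> u" using Cauchy_convergent convergent_def by blast
  have "u \<in> closure L" using u XL closure_sequential by blast
  moreover have "inner u h = f h" if h: "h \<in> L" for h
  proof -
    have quad: "0 \<le> 2 * t * (inner u h - f h) + t\<^sup>2 * (norm h)\<^sup>2" for t
    proof -
      have "0 \<le> 1 / real (Suc n) + (2 * t * (inner (X n) h - f h) + t\<^sup>2 * (norm h)\<^sup>2)" for n
      proof -
        have th: "t *\<^sub>R h \<in> L" using L h by (rule subspace_scale)
        have "X n + t *\<^sub>R h \<in> L" using L XL th by (intro subspace_add)
        from d_le[OF this] Xd[of n] have "0 \<le> 1 / real (Suc n) + (\<phi> (X n + t *\<^sub>R h) - \<phi> (X n))"
          by simp
        also have "\<phi> (X n + t *\<^sub>R h) - \<phi> (X n) = 2 * t * (inner (X n) h - f h) + t\<^sup>2 * (norm h)\<^sup>2"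
          unfolding \<phi>_def power2_norm_eq_inner
          by (simp add: add[OF XL th] scale[OF h] inner_add_left inner_add_right inner_commute
              power2_eq_square algebra_simps)
        finally show ?thesis .
      qed
      moreover have "(\<lambda>n. 1 / real (Suc n) + (2 * t * (inner (X n) h - f h) + t\<^sup>2 * (norm h)\<^sup>2))
          \<longlonglongrightarrow> 0 + (2 * t * (inner u h - f h) + t\<^sup>2 * (norm h)\<^sup>2)"
        using LIMSEQ_inverse_real_of_nat
        by (intro tendsto_intros u) (simp add: inverse_eq_divide)
      ultimately show ?thesis
        by (metis (no_types, lifting) LIMSEQ_le_const add_0)
    qed
    let ?D = "inner u h - f h" and ?N = "(norm h)\<^sup>2 + 1"
    \<comment> \<open>the quadratic inequality at a small multiple of \<open>- ?D\<close> forces \<open>?D = 0\<close>\<close>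
    have "0 \<le> 2 * (- ?D / ?N) * ?D + (- ?D / ?N)\<^sup>2 * (norm h)\<^sup>2" by (rule quad)
    also have "\<dots> \<le> 2 * (- ?D / ?N) * ?D + (- ?D / ?N)\<^sup>2 * ?N"
      by (intro add_left_mono mult_left_mono) auto
    also have "\<dots> = - (?D\<^sup>2 / ?N)"
    proof -
      have "?N \<noteq> 0" by (smt (verit) zero_le_power2)
      then show ?thesis by (simp add: divide_simps power2_eq_square) (simp add: algebra_simps)
    qed
    finally have "?D\<^sup>2 / ?N \<le> 0" by simp
    moreover have "0 < ?N" by (smt (verit) zero_le_power2)
    ultimately have "?D\<^sup>2 \<le> 0" by (simp add: divide_le_0_iff)
    then show ?thesis by simp
  qed
  ultimately show thesis by (rule that)
qed

lemma Cauchy_Schwarz_form: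
  fixes g :: "'a::real_vector \<Rightarrow> 'a \<Rightarrow> real"
  assumes sym: "\<And>x y. g x y = g y x"
    and add: "\<And>x y z. g (x + y) z = g x z + g y z"
    and scale: "\<And>c x y. g (c *\<^sub>R x) y = c * g x y"
    and pos: "\<And>x. 0 \<le> g x x"
  shows "(g x y)\<^sup>2 \<le> g x x * g y y"
proof -
  have add': "g z (x + y) = g z x + g z y" for x y z by (metis add sym)
  have scale': "g x (c *\<^sub>R y) = c * g x y" for c x y by (metis scale sym)
  have quad: "0 \<le> s\<^sup>2 * g x x + 2 * s * t * g x y + t\<^sup>2 * g y y" for s t
    using pos[of "s *\<^sub>R x + t *\<^sub>R y"] sym[of y x]
    by (simp add: add add' scale scale' power2_eq_square algebra_simps)
  show ?thesis
  proof (cases "g y y = 0")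
    case True
    have "g x y = 0"
    proof (rule ccontr)
      assume "g x y \<noteq> 0"
      \<comment> \<open>the quadratic is affine in \<open>t\<close>, and at this \<open>t\<close> its value is \<open>- 1\<close>\<close>
      then show False
        using quad[of 1 "- (g x x + 1) / (2 * g x y)"] True by (simp add: field_simps)
    qed
    then show ?thesis using True by simp
  next
    case False
    then have pos_y: "0 < g y y" using pos[of y] by simp
    have "0 \<le> g y y * (g x x * g y y - (g x y)\<^sup>2)"
      using quad[of "g y y" "- g x y"] by (simp add: power2_eq_square algebra_simps)
    then show ?thesis using pos_y by (simp add: zero_le_mult_iff)
  qed
qed


section \<open>Complex structure and positive operators\<close>

text \<open>The real inner product and multiplication by \<open>\<i>\<close> determine the complex structure: the imaginary
  part of \<open>cinner x y\<close> is \<open>inner (\<i> *\<^sub>C x) y\<close>, and a real-linear map is complex-linear as soon as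
  it commutes with \<open>\<i>\<close>.\<close>

lemma scaleC_scaleR_commute: "c *\<^sub>C (r *\<^sub>R x) = r *\<^sub>R (c *\<^sub>C (x::'a::complex_vector))"
  by (simp add: scaleR_scaleC scaleC_scaleC mult.commute)

lemma scaleC_minus1: "(- 1) *\<^sub>C x = - (x::'a::complex_vector)"
  using scaleR_scaleC[of "-1" x] by simp

lemma i_scaleC_i_scaleC: "\<i> *\<^sub>C (\<i> *\<^sub>C x) = - (x::'a::complex_vector)"
  by (simp add: scaleC_scaleC scaleC_minus1)

lemma scaleC_eq_Re_Im: "c *\<^sub>C x = Re c *\<^sub>R x + Im c *\<^sub>R (\<i> *\<^sub>C (x::'a::complex_vector))"
  by (simp add: scaleR_scaleC scaleC_scaleC scaleC_add_left[symmetric])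
    (metis complex_eq mult.commute)

lemma cinner_scaleC_left: "cinner (c *\<^sub>C x) y = cnj c * cinner x (y::'a::complex_inner)"
  by (metis cinner_commute cinner_scaleC_right complex_cnj_mult)

lemma Im_cinner: "Im (cinner x y) = inner (\<i> *\<^sub>C x) (y::'a::complex_inner)"
  by (simp add: inner_eq_Re_cinner cinner_scaleC_left)

lemma cinner_eq_Complex:
  "cinner x y = Complex (inner x y) (inner (\<i> *\<^sub>C x) (y::'a::complex_inner))"
  by (simp add: complex_eq_iff inner_eq_Re_cinner[symmetric] Im_cinner)

lemma inner_i_scaleC_both: "inner (\<i> *\<^sub>C x) (\<i> *\<^sub>C y) = inner x (y::'a::complex_inner)"
  by (simp add: inner_eq_Re_cinner cinner_scaleC_left cinner_scaleC_right)

lemma inner_i_scaleC_left: "inner (\<i> *\<^sub>C x) y = - inner x (\<i> *\<^sub>C (y::'a::complex_inner))"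
  using inner_i_scaleC_both[of x "\<i> *\<^sub>C y"] by (simp add: i_scaleC_i_scaleC)

lemma norm_i_scaleC: "norm (\<i> *\<^sub>C x) = norm (x::'a::complex_inner)"
  by (simp add: norm_eq_sqrt_inner inner_i_scaleC_both)

lemma bounded_linear_scaleC: "bounded_linear (\<lambda>x::'a::complex_inner. c *\<^sub>C x)"
proof -
  have i: "bounded_linear (\<lambda>x::'a. \<i> *\<^sub>C x)"
    by (rule bounded_linear_intro[where K = 1])
      (simp_all add: scaleC_add_right scaleC_scaleR_commute norm_i_scaleC)
  show ?thesis
    by (subst scaleC_eq_Re_Im) (intro bounded_linear_add bounded_linear_scaleR_right
        bounded_linear_compose[OF bounded_linear_scaleR_right i] bounded_linear_ident
        bounded_linear_const_scaleR)
qed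

lemma i_commute_imp_scaleC:
  fixes T :: "'a::complex_vector \<Rightarrow> 'b::complex_vector"
  assumes "linear T" "\<And>x. T (\<i> *\<^sub>C x) = \<i> *\<^sub>C T x"
  shows "T (c *\<^sub>C x) = c *\<^sub>C T x"
  by (subst (1 2) scaleC_eq_Re_Im) (simp add: assms linear_add linear_scale)

text \<open>A sesquilinear form with real values on the diagonal is Hermitian. The set \<open>S\<close> need not be
  closed under real multiples, since the polarization uses only sums and multiplication by
  \<open>\<i>\<close>.\<close>

lemma symmetric_if_cinner_real:
  fixes A :: "'a::complex_inner \<Rightarrow> 'a"
  assumes S: "\<And>x y. x \<in> S \<Longrightarrow> y \<in> S \<Longrightarrow> x + y \<in> S" "\<And>x. x \<in> S \<Longrightarrow> \<i> *\<^sub>C x \<in> S"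
    and add: "\<And>x y. x \<in> S \<Longrightarrow> y \<in> S \<Longrightarrow> A (x + y) = A x + A y"
    and i: "\<And>x. x \<in> S \<Longrightarrow> A (\<i> *\<^sub>C x) = \<i> *\<^sub>C A x"
    and real: "\<And>x. x \<in> S \<Longrightarrow> Im (cinner x (A x)) = 0"
    and x: "x \<in> S" and y: "y \<in> S"
  shows "inner x (A y) = inner (A x) y"
proof -
  have polar: "inner (\<i> *\<^sub>C u) (A v) + inner (\<i> *\<^sub>C v) (A u) = 0" if "u \<in> S" "v \<in> S" for u v
    using real[OF S(1)[OF that]] real[OF that(1)] real[OF that(2)] that
    by (simp add: Im_cinner add scaleC_add_right inner_add_left inner_add_right)
  have "inner (\<i> *\<^sub>C (\<i> *\<^sub>C x)) (A y) + inner (\<i> *\<^sub>C y) (\<i> *\<^sub>C A x) = 0"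
    using polar[of "\<i> *\<^sub>C x" y] S(2) x y i by metis
  then show ?thesis
    by (simp add: i_scaleC_i_scaleC inner_i_scaleC_both inner_commute)
qed

text \<open>In terms of the real inner product, a positive operator is a bounded linear map that commutes
  with \<open>\<i>\<close>, is symmetric, and has a nonnegative form.\<close>

lemma positive_ops_UNIV_iff:
  "A \<in> positive_ops (UNIV :: 'a::complex_hilbert set) \<longleftrightarrow>
    bounded_linear A \<and> (\<forall>x. A (\<i> *\<^sub>C x) = \<i> *\<^sub>C A x) \<and>
    (\<forall>x y. inner x (A y) = inner (A x) y) \<and> (\<forall>x. 0 \<le> inner x (A x))"
proof
  assume A: "A \<in> positive_ops UNIV"
  then have bl: "bounded_linear A" and sc: "\<And>c x. A (c *\<^sub>C x) = c *\<^sub>C A x"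
    by (auto simp: positive_ops_def bounded_ops_UNIV)
  have pos: "Im (cinner x (A x)) = 0 \<and> 0 \<le> inner x (A x)" for x
    using A by (auto simp: positive_ops_def complex_nonneg_Reals_iff inner_eq_Re_cinner)
  have "inner x (A y) = inner (A x) y" for x y
    by (rule symmetric_if_cinner_real[where S = UNIV])
      (use bl sc pos in \<open>auto simp: linear_add[OF bounded_linear.linear]\<close>)
  then show "bounded_linear A \<and> (\<forall>x. A (\<i> *\<^sub>C x) = \<i> *\<^sub>C A x) \<and>
    (\<forall>x y. inner x (A y) = inner (A x) y) \<and> (\<forall>x. 0 \<le> inner x (A x))"
    using bl sc pos by blast
next
  assume A: "bounded_linear A \<and> (\<forall>x. A (\<i> *\<^sub>C x) = \<i> *\<^sub>C A x) \<and>
    (\<forall>x y. inner x (A y) = inner (A x) y) \<and> (\<forall>x. 0 \<le> inner x (A x))"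
  have "Im (cinner x (A x)) = 0" for x
  proof -
    have "inner (\<i> *\<^sub>C x) (A x) = inner (\<i> *\<^sub>C A x) x"
      using A by metis
    also have "\<dots> = - inner (\<i> *\<^sub>C x) (A x)"
      using inner_i_scaleC_left[of "A x" x] inner_commute[of "A x" "\<i> *\<^sub>C x"] by linarith
    finally show ?thesis by (simp add: Im_cinner)
  qed
  then show "A \<in> positive_ops UNIV"
    using A i_commute_imp_scaleC[OF bounded_linear.linear, of A]
    by (auto simp: positive_ops_def bounded_ops_UNIV complex_nonneg_Reals_iff inner_eq_Re_cinner)
qed

lemma positive_opsD:
  assumes "A \<in> positive_ops (UNIV :: 'a::complex_hilbert set)"
  shows "bounded_linear A" "linear A" "A (c *\<^sub>C x) = c *\<^sub>C A x" "inner x (A y) = inner (A x) y"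
    "0 \<le> inner x (A x)" "A (x + y) = A x + A y" "A (x - y) = A x - A y" "A (r *\<^sub>R x) = r *\<^sub>R A x"
    "A 0 = 0"
proof -
  show bl: "bounded_linear A" and "A (c *\<^sub>C x) = c *\<^sub>C A x" "inner x (A y) = inner (A x) y"
    "0 \<le> inner x (A x)"
    using assms by (auto simp: positive_ops_UNIV_iff)
      (use assms in \<open>auto simp: positive_ops_def bounded_ops_UNIV\<close>)
  then interpret bounded_linear A by simp
  show "linear A" "A (x + y) = A x + A y" "A (x - y) = A x - A y" "A (r *\<^sub>R x) = r *\<^sub>R A x" "A 0 = 0"
    by (fact linear add diff scaleR zero)+
qed

lemma positive_op_Cauchy_Schwarz:
  assumes A: "A \<in> positive_ops (UNIV :: 'a::complex_hilbert set)"
  shows "(inner x (A y))\<^sup>2 \<le> inner x (A x) * inner y (A y)"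
proof (rule Cauchy_Schwarz_form[where g = "\<lambda>x y. inner x (A y)"])
  show "inner x (A y) = inner y (A x)" for x y
    using positive_opsD(4)[OF A, of x y] by (simp add: inner_commute)
qed (simp_all add: positive_opsD(5)[OF A] inner_add_left)

lemma positive_op_eq_0_if_form_0:
  assumes A: "A \<in> positive_ops (UNIV :: 'a::complex_hilbert set)" and "inner x (A x) = 0"
  shows "A x = 0"
  using positive_op_Cauchy_Schwarz[OF A, of "A x" x] assms(2) by simp

text \<open>If \<open>0 \<le> A \<le> I\<close>, then \<open>A\<close> has norm at most one, by Cauchy-Schwarz for the form of \<open>A\<close>.\<close>

lemma norm_positive_op_le:
  assumes A: "A \<in> positive_ops (UNIV :: 'a::complex_hilbert set)"
    and le: "\<And>x. inner x (A x) \<le> (norm x)\<^sup>2"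
  shows "norm (A x) \<le> norm x"
proof -
  have "((norm (A x))\<^sup>2)\<^sup>2 = (inner (A x) (A x))\<^sup>2"
    by (simp add: power2_norm_eq_inner)
  also have "\<dots> \<le> inner (A x) (A (A x)) * inner x (A x)"
    by (rule positive_op_Cauchy_Schwarz[OF A])
  also have "\<dots> \<le> (norm (A x))\<^sup>2 * (norm x)\<^sup>2"
    using le positive_opsD(5)[OF A] by (intro mult_mono) auto
  finally have *: "(norm (A x))\<^sup>2 * (norm (A x))\<^sup>2 \<le> (norm (A x))\<^sup>2 * (norm x)\<^sup>2"
    by (simp only: power2_eq_square[of "(norm (A x))\<^sup>2"])
  show ?thesis
  proof (cases "A x = 0")
    case False
    then have "0 < (norm (A x))\<^sup>2" by simp
    with * have "(norm (A x))\<^sup>2 \<le> (norm x)\<^sup>2" by (rule mult_left_le_imp_le)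
    then show ?thesis by (rule power2_le_imp_le) simp
  qed simp
qed

lemma id_positive_op: "id \<in> positive_ops (UNIV :: 'a::complex_hilbert set)"
  by (simp add: positive_ops_UNIV_iff id_def)

lemma positive_op_scaleR:
  assumes A: "A \<in> positive_ops (UNIV :: 'a::complex_hilbert set)" and "0 \<le> r"
  shows "(\<lambda>x. r *\<^sub>R A x) \<in> positive_ops UNIV"
  using assms positive_opsD(1)[OF A]
  by (auto simp: positive_ops_UNIV_iff scaleC_scaleR_commute
      intro!: bounded_linear_compose[OF bounded_linear_scaleR_right])


section \<open>Square roots of positive operators\<close>

subsection \<open>The binomial series of the square root\<close>

text \<open>The coefficients of \<open>sqrt (1 - t) = (\<Sum>n. sqrt_coeff n * t ^ n)\<close>. All but the first are
  nonpositive and the partial sums are nonnegative, so the series converges absolutely for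
  \<open>\<bar>t\<bar> \<le> 1\<close>.\<close>

definition sqrt_coeff :: "nat \<Rightarrow> real" where
  "sqrt_coeff n = pochhammer (- 1 / 2) n / fact n"

lemma sqrt_coeff_0: "sqrt_coeff 0 = 1"
  by (simp add: sqrt_coeff_def)

lemma sqrt_coeff_nonpos: "0 < n \<Longrightarrow> sqrt_coeff n \<le> 0"
proof -
  assume "0 < n"
  then obtain k where n: "n = Suc k" by (cases n) auto
  have "0 \<le> pochhammer (1/2::real) k" by (rule pochhammer_nonneg) simp
  then show ?thesis
    by (simp add: n sqrt_coeff_def pochhammer_rec divide_le_0_iff)
qed

lemma sum_sqrt_coeff: "(\<Sum>k\<le>n. sqrt_coeff k) = pochhammer (1/2) n / fact n"
proof (induction n)
  case (Suc n)
  have "(\<Sum>k\<le>Suc n. sqrt_coeff k) =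
      pochhammer (1/2) n / fact n - 1 / 2 * pochhammer (1/2) n / fact (Suc n)"
    using Suc by (simp add: sqrt_coeff_def pochhammer_rec)
  also have "\<dots> = pochhammer (1/2) n * (1/2 + real n) / fact (Suc n)"
    by (simp add: divide_simps) (simp add: algebra_simps)
  finally show ?case by (simp add: pochhammer_Suc)
qed (simp add: sqrt_coeff_0)

lemma sum_sqrt_coeff_nonneg: "0 \<le> (\<Sum>k<n. sqrt_coeff k)"
  by (cases n) (simp_all add: lessThan_Suc_atMost sum_sqrt_coeff pochhammer_nonneg
      del: sum.lessThan_Suc)

lemma summable_abs_sqrt_coeff: "summable (\<lambda>n. \<bar>sqrt_coeff n\<bar>)"
proof (rule bounded_imp_summable)
  fix n
  have "(\<Sum>k\<le>n. \<bar>sqrt_coeff k\<bar>) = (\<Sum>k\<le>n. (if k = 0 then 2 else 0) - sqrt_coeff k)"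
    using sqrt_coeff_nonpos by (intro sum.cong) (auto simp: sqrt_coeff_0)
  also have "\<dots> = 2 - (\<Sum>k\<le>n. sqrt_coeff k)"
    by (simp add: sum_subtractf)
  also have "\<dots> \<le> 2"
    by (simp add: sum_sqrt_coeff pochhammer_nonneg)
  finally show "(\<Sum>k\<le>n. \<bar>sqrt_coeff k\<bar>) \<le> 2" .
qed simp

lemma sqrt_coeff_convolution:
  "(\<Sum>k\<le>n. sqrt_coeff k * sqrt_coeff (n - k)) = (if n = 0 then 1 else if n = 1 then - 1 else 0)"
proof -
  have "(\<Sum>k\<le>n. sqrt_coeff k * sqrt_coeff (n - k)) = pochhammer (- 1 / 2 + - 1 / 2) n / fact n"
    unfolding pochhammer_binomial_sum sum_divide_distrib sqrt_coeff_def
    by (intro sum.cong refl) (simp add: binomial_fact divide_simps)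
  also have "\<dots> = (if n = 0 then 1 else if n = 1 then - 1 else 0)"
  proof -
    consider "n = 0" | "n = 1" | k where "n = Suc (Suc k)"
      by (metis One_nat_def not0_implies_Suc)
    then show ?thesis by cases (simp_all add: pochhammer_rec pochhammer_0_left)
  qed
  finally show ?thesis .
qed

text \<open>For \<open>v n = (A ^^ n) x\<close> with \<open>A\<close> power-bounded, this multiplies two absolutely summable power
  series in \<open>A\<close>.\<close>

lemma Cauchy_product_scaleR:
  fixes v :: "nat \<Rightarrow> 'a::banach"
  assumes a: "summable (\<lambda>n. \<bar>a n\<bar>)" and b: "summable (\<lambda>n. \<bar>b n\<bar>)" and v: "\<And>n. norm (v n) \<le> M"
  shows "(\<Sum>j. a j *\<^sub>R (\<Sum>k. b k *\<^sub>R v (j + k))) = (\<Sum>n. (\<Sum>i\<le>n. a i * b (n - i)) *\<^sub>R v n)"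
proof -
  \<comment> \<open>the double series, indexed by pairs of factors and by diagonals\<close>
  define F where "F = (\<lambda>(j, k). (a j * b k) *\<^sub>R v (j + k))"
  define G where "G = (\<lambda>(n, i). (a i * b (n - i)) *\<^sub>R v n)"
  have infsum_nat: "infsum f UNIV = suminf f" if "f summable_on UNIV" for f :: "nat \<Rightarrow> 'a"
    using has_sum_imp_sums[OF has_sum_infsum[OF that]] by (simp add: sums_iff)
  have "(\<lambda>p. norm (case p of (j, k) \<Rightarrow> a j * (b k * M))) summable_on (UNIV \<times> UNIV)"
  proof (subst Infinite_Sum.abs_summable_on_Sigma_iff, intro conjI ballI)
    have "(\<lambda>k. \<bar>b k\<bar>) summable_on UNIV"
      using b by (intro norm_summable_imp_summable_on) simp
    then have bM: "(\<lambda>k. \<bar>b k\<bar> * \<bar>M\<bar>) summable_on UNIV"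
      by (rule summable_on_cmult_left)
    then have "(\<lambda>k. \<bar>a j\<bar> * (\<bar>b k\<bar> * \<bar>M\<bar>)) summable_on UNIV" for j
      by (rule summable_on_cmult_right)
    then show "(\<lambda>k. norm (case (j, k) of (j, k) \<Rightarrow> a j * (b k * M))) summable_on UNIV" for j
      by (simp add: abs_mult)
    have "(\<lambda>j. \<bar>a j\<bar>) summable_on UNIV"
      using a by (intro norm_summable_imp_summable_on) simp
    then have "(\<lambda>j. \<bar>a j\<bar> * infsum (\<lambda>k. \<bar>b k\<bar> * \<bar>M\<bar>) UNIV) summable_on UNIV"
      by (rule summable_on_cmult_left)
    then show "(\<lambda>j. norm (\<Sum>\<^sub>\<infinity>k. norm (case (j, k) of (j, k) \<Rightarrow> a j * (b k * M)))) summable_on UNIV"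
      by (simp add: abs_mult infsum_cmult_right bM infsum_nonneg)
  qed
  then have "(\<lambda>p. norm (F p)) summable_on (UNIV \<times> UNIV)"
  proof (rule Infinite_Sum.abs_summable_on_comparison_test)
    fix p :: "nat \<times> nat"
    have "norm (v n) \<le> \<bar>M\<bar>" for n using v[of n] by linarith
    then show "norm (F p) \<le> norm (case p of (j, k) \<Rightarrow> a j * (b k * M))"
      by (cases p) (auto simp: F_def abs_mult mult.assoc intro!: mult_left_mono)
  qed
  then have F: "F summable_on (UNIV \<times> UNIV)" by (rule Infinite_Sum.abs_summable_summable)
  have FG: "F summable_on (UNIV \<times> UNIV) \<longleftrightarrow> G summable_on (SIGMA n:UNIV. {..n})"
    by (rule summable_on_reindex_bij_witness
        [where i = "\<lambda>(n, i). (i, n - i)" and j = "\<lambda>(j, k). (j + k, j)"])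
      (auto simp: F_def G_def)
  then have G: "G summable_on (SIGMA n:UNIV. {..n})" using F by simp
  have inner: "(\<lambda>k. b k *\<^sub>R v (j + k)) summable_on UNIV" for j
  proof (rule norm_summable_imp_summable_on)
    show "summable (\<lambda>k. norm (b k *\<^sub>R v (j + k)))"
      by (rule summable_comparison_test'[OF summable_mult2[OF b, of M]])
        (auto intro!: mult_left_mono v)
  qed
  have row: "(\<Sum>\<^sub>\<infinity>k. F (j, k)) = a j *\<^sub>R (\<Sum>k. b k *\<^sub>R v (j + k))" for j
  proof -
    have "(\<Sum>\<^sub>\<infinity>k. F (j, k)) = (\<Sum>\<^sub>\<infinity>k. a j *\<^sub>R (b k *\<^sub>R v (j + k)))"
      by (simp add: F_def)
    also have "\<dots> = a j *\<^sub>R (\<Sum>k. b k *\<^sub>R v (j + k))"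
      by (simp only: infsum_scaleR_right infsum_nat[OF inner])
    finally show ?thesis .
  qed
  have "infsum F (UNIV \<times> UNIV) = (\<Sum>\<^sub>\<infinity>j. \<Sum>\<^sub>\<infinity>k. F (j, k))"
    by (rule infsum_Sigma_banach[OF F, symmetric])
  also have "\<dots> = (\<Sum>\<^sub>\<infinity>j. a j *\<^sub>R (\<Sum>k. b k *\<^sub>R v (j + k)))"
    by (simp only: row)
  also have "\<dots> = (\<Sum>j. a j *\<^sub>R (\<Sum>k. b k *\<^sub>R v (j + k)))"
  proof (rule infsum_nat)
    have "(\<lambda>j. \<Sum>\<^sub>\<infinity>k. F (j, k)) summable_on UNIV"
      using summable_on_Sigma_banach[of "\<lambda>j k. F (j, k)" UNIV "\<lambda>_. UNIV"] F by simp
    then show "(\<lambda>j. a j *\<^sub>R (\<Sum>k. b k *\<^sub>R v (j + k))) summable_on UNIV"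
      by (simp only: row)
  qed
  finally have lhs: "infsum F (UNIV \<times> UNIV) = (\<Sum>j. a j *\<^sub>R (\<Sum>k. b k *\<^sub>R v (j + k)))" .
  have "infsum F (UNIV \<times> UNIV) = infsum G (SIGMA n:UNIV. {..n})"
    by (rule infsum_reindex_bij_witness
        [where i = "\<lambda>(n, i). (i, n - i)" and j = "\<lambda>(j, k). (j + k, j)"])
      (auto simp: F_def G_def)
  also have "\<dots> = (\<Sum>\<^sub>\<infinity>n. \<Sum>\<^sub>\<infinity>i\<in>{..n}. G (n, i))"
    by (rule infsum_Sigma_banach[OF G, symmetric])
  also have "\<dots> = (\<Sum>\<^sub>\<infinity>n. (\<Sum>i\<le>n. a i * b (n - i)) *\<^sub>R v n)"
    by (simp add: G_def scaleR_sum_left)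
  also have "\<dots> = (\<Sum>n. (\<Sum>i\<le>n. a i * b (n - i)) *\<^sub>R v n)"
  proof (rule infsum_nat)
    have "(\<lambda>n. \<Sum>\<^sub>\<infinity>i\<in>{..n}. G (n, i)) summable_on UNIV"
      using summable_on_Sigma_banach[of "\<lambda>n i. G (n, i)" UNIV "\<lambda>n. {..n}"] G by simp
    then show "(\<lambda>n. (\<Sum>i\<le>n. a i * b (n - i)) *\<^sub>R v n) summable_on UNIV"
      by (simp add: G_def scaleR_sum_left)
  qed
  finally show ?thesis using lhs by simp
qed

subsection \<open>Existence and uniqueness of the positive square root\<close>

text \<open>For \<open>0 \<le> A \<le> I\<close> the root of \<open>I - A\<close> is \<open>R = (\<Sum>n. sqrt_coeff n *\<^sub>R A ^^ n)\<close>. It commutes with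
  everything that commutes with \<open>A\<close>, which is what uniqueness rests on.\<close>

lemma contraction_sqrt_exists:
  fixes A :: "'a::complex_hilbert \<Rightarrow> 'a"
  assumes A: "A \<in> positive_ops UNIV" and le: "\<And>x. inner x (A x) \<le> (norm x)\<^sup>2"
  obtains R where "R \<in> positive_ops UNIV" "\<And>x. R (R x) = x - A x"
    "\<And>C x. bounded_linear C \<Longrightarrow> (\<And>y. C (A y) = A (C y)) \<Longrightarrow> C (R x) = R (C x)"
proof -
  define R where "R x = (\<Sum>n. sqrt_coeff n *\<^sub>R (A ^^ n) x)" for x
  have contr: "norm ((A ^^ n) x) \<le> norm x" for n x
    by (induction n) (auto intro: order_trans[OF norm_positive_op_le[OF A le]])
  have pow: "bounded_linear (A ^^ n)" for n
    by (induction n) (auto simp: id_def o_def positive_opsD(1)[OF A]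
        intro: bounded_linear_compose[OF positive_opsD(1)[OF A]])
  have sym: "inner x ((A ^^ n) y) = inner ((A ^^ n) x) y" for n x y
    by (induction n arbitrary: x y) (simp_all add: positive_opsD(4)[OF A] funpow_swap1)
  have "norm (sqrt_coeff n *\<^sub>R (A ^^ n) x) \<le> \<bar>sqrt_coeff n\<bar> * norm x" for n x
    using contr by (auto intro: mult_left_mono)
  note norm_le = this
  have nsummable: "summable (\<lambda>n. norm (sqrt_coeff n *\<^sub>R (A ^^ n) x))" for x
    by (rule summable_comparison_test'[OF summable_mult2[OF summable_abs_sqrt_coeff, of "norm x"]])
      (use norm_le in auto)
  then have summable: "summable (\<lambda>n. sqrt_coeff n *\<^sub>R (A ^^ n) x)" for x
    by (rule summable_norm_cancel)
  have commute: "C (R x) = R (C x)"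
    if C: "bounded_linear C" and CA: "\<And>y. C (A y) = A (C y)" for C x
  proof -
    have "C ((A ^^ n) x) = (A ^^ n) (C x)" for n
      by (induction n) (simp_all add: CA)
    then show ?thesis
      by (simp add: R_def bounded_linear.suminf[OF C summable]
          linear_scale[OF bounded_linear.linear[OF C]])
  qed
  have "bounded_linear R"
  proof (rule bounded_linear_intro[where K = "\<Sum>n. \<bar>sqrt_coeff n\<bar>"])
    show "R (x + y) = R x + R y" for x y
      unfolding R_def by (subst suminf_add[OF summable summable])
        (simp add: linear_add[OF bounded_linear.linear[OF pow]] scaleR_add_right)
    show "R (r *\<^sub>R x) = r *\<^sub>R R x" for r x
      using commute[of "\<lambda>x. r *\<^sub>R x" x]
      by (simp add: bounded_linear_scaleR_right positive_opsD(8)[OF A])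
    fix x
    have "norm (R x) \<le> (\<Sum>n. norm (sqrt_coeff n *\<^sub>R (A ^^ n) x))"
      unfolding R_def by (rule summable_norm[OF nsummable])
    also have "\<dots> \<le> (\<Sum>n. \<bar>sqrt_coeff n\<bar> * norm x)"
      by (rule suminf_le[OF norm_le nsummable summable_mult2[OF summable_abs_sqrt_coeff]])
    also have "\<dots> = norm x * (\<Sum>n. \<bar>sqrt_coeff n\<bar>)"
      using suminf_mult2[OF summable_abs_sqrt_coeff, of "norm x"] by (simp only: mult.commute[of "norm x"])
    finally show "norm (R x) \<le> norm x * (\<Sum>n. \<bar>sqrt_coeff n\<bar>)" .
  qed
  moreover have "R (\<i> *\<^sub>C x) = \<i> *\<^sub>C R x" for x
    using commute[OF bounded_linear_scaleC[of \<i>]] by (simp add: positive_opsD(3)[OF A])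
  moreover have form: "(\<lambda>n. sqrt_coeff n * inner x ((A ^^ n) y)) sums inner x (R y)" for x y
    using bounded_linear.sums[OF bounded_linear_inner_right[of x] summable_sums[OF summable[of y]]]
    by (simp add: R_def)
  moreover have "inner x (R y) = inner (R x) y" for x y
  proof (rule sums_unique2[OF form[of x y]])
    show "(\<lambda>n. sqrt_coeff n * inner x ((A ^^ n) y)) sums inner (R x) y"
      using form[of y x] by (simp only: inner_commute[of y] sym[of x])
  qed
  moreover have "0 \<le> inner x (R x)" for x
  proof -
    have "0 \<le> (\<Sum>n<N. sqrt_coeff n * inner x ((A ^^ n) x))" for N
    proof -
      \<comment> \<open>the nonpositive coefficients multiply forms that are at most \<open>norm x ^ 2\<close>\<close>
      have "0 \<le> (\<Sum>n<N. sqrt_coeff n) * (norm x)\<^sup>2"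
        using sum_sqrt_coeff_nonneg by simp
      also have "\<dots> = (\<Sum>n<N. sqrt_coeff n * (norm x)\<^sup>2)"
        by (simp add: sum_distrib_right)
      also have "\<dots> \<le> (\<Sum>n<N. sqrt_coeff n * inner x ((A ^^ n) x))"
      proof (rule sum_mono)
        fix n
        have "inner x ((A ^^ n) x) \<le> norm x * norm ((A ^^ n) x)"
          by (rule norm_cauchy_schwarz)
        also have "\<dots> \<le> (norm x)\<^sup>2"
          using contr by (auto simp: power2_eq_square intro: mult_left_mono)
        finally show "sqrt_coeff n * (norm x)\<^sup>2 \<le> sqrt_coeff n * inner x ((A ^^ n) x)"
          using sqrt_coeff_nonpos[of n]
          by (cases "n = 0") (auto simp: power2_norm_eq_inner intro: mult_left_mono_neg)
      qed
      finally show ?thesis .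
    qed
    then show ?thesis
      using form[of x x] unfolding sums_def by (intro LIMSEQ_le_const) auto
  qed
  ultimately have "R \<in> positive_ops UNIV"
    by (simp add: positive_ops_UNIV_iff)
  moreover have "R (R x) = x - A x" for x
  proof -
    have "R (R x) = (\<Sum>j. sqrt_coeff j *\<^sub>R (\<Sum>k. sqrt_coeff k *\<^sub>R (A ^^ (j + k)) x))"
      unfolding R_def[of "R x"]
      by (simp add: R_def bounded_linear.suminf[OF pow summable] funpow_add
          linear_scale[OF bounded_linear.linear[OF pow]])
    also have "\<dots> = (\<Sum>n. (\<Sum>i\<le>n. sqrt_coeff i * sqrt_coeff (n - i)) *\<^sub>R (A ^^ n) x)"
      using contr by (intro Cauchy_product_scaleR summable_abs_sqrt_coeff)
    also have "\<dots> = (\<Sum>n\<in>{0, 1}. (\<Sum>i\<le>n. sqrt_coeff i * sqrt_coeff (n - i)) *\<^sub>R (A ^^ n) x)"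
      by (rule suminf_finite) (auto simp: sqrt_coeff_convolution)
    also have "\<dots> = x - A x"
      by (simp add: sqrt_coeff_convolution del: One_nat_def) simp
    finally show ?thesis .
  qed
  ultimately show thesis
    using commute by (rule that)
qed

text \<open>The general case follows by rescaling: for \<open>K\<close> an upper bound of the norm of \<open>T\<close>, both
  \<open>A = I - T / K\<close> and \<open>I - A\<close> are positive.\<close>

lemma positive_sqrt_exists:
  fixes T :: "'a::complex_hilbert \<Rightarrow> 'a"
  assumes T: "T \<in> positive_ops UNIV"
  obtains R where "R \<in> positive_ops UNIV" "\<And>x. R (R x) = T x"
    "\<And>C x. bounded_linear C \<Longrightarrow> (\<And>y. C (T y) = T (C y)) \<Longrightarrow> C (R x) = R (C x)"
proof -
  obtain K where K: "0 < K" "\<And>x. norm (T x) \<le> norm x * K"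
    using bounded_linear.pos_bounded[OF positive_opsD(1)[OF T]] by blast
  define A where "A x = x - (1 / K) *\<^sub>R T x" for x
  have T_le: "inner x (T x) \<le> K * (norm x)\<^sup>2" for x
  proof -
    have "inner x (T x) \<le> norm x * norm (T x)" by (rule norm_cauchy_schwarz)
    also have "\<dots> \<le> norm x * (norm x * K)" using K by (intro mult_left_mono) auto
    finally show ?thesis by (simp add: power2_eq_square mult_ac)
  qed
  have A: "A \<in> positive_ops UNIV"
    unfolding positive_ops_UNIV_iff
  proof (intro conjI allI)
    show "bounded_linear A"
      unfolding A_def by (intro bounded_linear_sub bounded_linear_ident
          bounded_linear_compose[OF bounded_linear_scaleR_right] positive_opsD(1)[OF T])
    show "A (\<i> *\<^sub>C x) = \<i> *\<^sub>C A x" for x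
      by (simp add: A_def positive_opsD(3)[OF T] scaleC_scaleR_commute
          linear_diff[OF bounded_linear.linear[OF bounded_linear_scaleC]])
    show "inner x (A y) = inner (A x) y" for x y
      using positive_opsD(4)[OF T, of x y]
      by (simp add: A_def inner_diff_left inner_diff_right)
    show "0 \<le> inner x (A x)" for x
      using T_le[of x] K(1)
      by (simp add: A_def inner_diff_right power2_norm_eq_inner divide_le_eq mult.commute)
  qed
  have A_le: "inner x (A x) \<le> (norm x)\<^sup>2" for x
    using positive_opsD(5)[OF T, of x] K(1)
    by (simp add: A_def inner_diff_right power2_norm_eq_inner)
  obtain Q where Q: "Q \<in> positive_ops UNIV" "\<And>x. Q (Q x) = x - A x"
    "\<And>C x. bounded_linear C \<Longrightarrow> (\<And>y. C (A y) = A (C y)) \<Longrightarrow> C (Q x) = Q (C x)"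
    using contraction_sqrt_exists[OF A A_le] by blast
  show thesis
  proof (rule that[of "\<lambda>x. sqrt K *\<^sub>R Q x"])
    show "(\<lambda>x. sqrt K *\<^sub>R Q x) \<in> positive_ops UNIV"
      using Q(1) K(1) by (intro positive_op_scaleR) auto
    show "sqrt K *\<^sub>R Q (sqrt K *\<^sub>R Q x) = T x" for x
      using K(1) by (simp add: positive_opsD(8)[OF Q(1)] Q(2) A_def)
    fix C x assume C: "bounded_linear C" and CT: "\<And>y. C (T y) = T (C y)"
    then interpret C: bounded_linear C by simp
    have "C (A y) = A (C y)" for y
      by (simp add: A_def C.diff C.scaleR CT)
    from Q(3)[OF C this] show "C (sqrt K *\<^sub>R Q x) = sqrt K *\<^sub>R Q (C x)"
      by (simp add: C.scaleR)
  qed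
qed

lemma positive_sqrt_unique:
  fixes T :: "'a::complex_hilbert \<Rightarrow> 'a"
  assumes T: "T \<in> positive_ops UNIV"
  shows "\<exists>!R. R \<in> positive_ops UNIV \<and> R \<circ> R = T"
proof -
  obtain R where R: "R \<in> positive_ops UNIV" "\<And>x. R (R x) = T x"
    "\<And>C x. bounded_linear C \<Longrightarrow> (\<And>y. C (T y) = T (C y)) \<Longrightarrow> C (R x) = R (C x)"
    using positive_sqrt_exists[OF T] by blast
  have "S = R" if S: "S \<in> positive_ops UNIV" and SS: "S \<circ> S = T" for S
  proof
    fix x
    have SS': "S (S y) = T y" for y using SS by (metis comp_apply)
    have SR: "S (R y) = R (S y)" for y
      by (rule R(3)[OF positive_opsD(1)[OF S]]) (metis SS')
    define y where "y = R x - S x"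
    \<comment> \<open>\<open>(R + S) (R - S) = R\<^sup>2 - S\<^sup>2 = 0\<close>, hence both positive forms vanish at \<open>y = (R - S) x\<close>\<close>
    have "R y + S y = 0"
      by (simp add: y_def positive_opsD(7)[OF R(1)] positive_opsD(7)[OF S] R(2) SS' SR)
    then have "inner y (R y) + inner y (S y) = 0"
      by (metis inner_add_right inner_zero_right)
    then have "inner y (R y) = 0" "inner y (S y) = 0"
      using positive_opsD(5)[OF R(1), of y] positive_opsD(5)[OF S, of y] by linarith+
    then have "R y = 0" "S y = 0"
      using positive_op_eq_0_if_form_0 R(1) S by blast+
    have "inner y y = inner (R x) y - inner (S x) y"
      by (subst (1) y_def) (simp add: inner_diff_left)
    also have "\<dots> = inner x (R y) - inner x (S y)"
      by (simp add: positive_opsD(4)[OF R(1)] positive_opsD(4)[OF S])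
    also have "\<dots> = 0"
      using \<open>R y = 0\<close> \<open>S y = 0\<close> by simp
    finally show "S x = R x" by (simp add: y_def)
  qed
  moreover have "R \<circ> R = T" using R(2) by auto
  ultimately show ?thesis using R(1) by blast
qed

lemma op_sqrt:
  assumes "T \<in> positive_ops (UNIV :: 'a::complex_hilbert set)"
  shows op_sqrt_positive: "op_sqrt T \<in> positive_ops UNIV"
    and op_sqrt_op_sqrt: "op_sqrt T (op_sqrt T x) = T x"
proof -
  have "op_sqrt T \<in> positive_ops UNIV \<and> op_sqrt T \<circ> op_sqrt T = T"
    unfolding op_sqrt_def by (rule theI'[OF positive_sqrt_unique[OF assms]])
  then show "op_sqrt T \<in> positive_ops UNIV" "op_sqrt T (op_sqrt T x) = T x"
    by (auto simp: fun_eq_iff)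
qed

lemma inner_op_sqrt_op_sqrt:
  assumes "T \<in> positive_ops (UNIV :: 'a::complex_hilbert set)"
  shows "inner (op_sqrt T x) (op_sqrt T y) = inner x (T y)"
  using positive_opsD(4)[OF op_sqrt_positive[OF assms], of x "op_sqrt T y"]
  by (simp add: op_sqrt_op_sqrt[OF assms])


section \<open>Compression to the support of a positive operator\<close>

subsection \<open>Orthogonal projections and extension by zero\<close>

text \<open>A complex linear subspace: a real one that is closed under multiplication by \<open>\<i>\<close>.\<close>

definition complex_subspace :: "'a::complex_inner set \<Rightarrow> bool" where
  "complex_subspace S \<longleftrightarrow> subspace S \<and> (\<forall>x\<in>S. \<i> *\<^sub>C x \<in> S)"

lemma complex_subspace_imp_subspace: "complex_subspace S \<Longrightarrow> subspace S"
  by (simp add: complex_subspace_def)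

lemma complex_subspace_scaleC: "complex_subspace S \<Longrightarrow> x \<in> S \<Longrightarrow> c *\<^sub>C x \<in> S"
  by (subst scaleC_eq_Re_Im) (auto simp: complex_subspace_def intro!: subspace_add subspace_scale)

lemma subspace_closure:
  fixes S :: "'a::real_normed_vector set"
  assumes S: "subspace S"
  shows "subspace (closure S)"
proof (rule subspaceI)
  show "0 \<in> closure S"
    using closure_subset subspace_0[OF S] by blast
  fix x y and c :: real
  assume "x \<in> closure S"
  then obtain f where f: "\<And>n. f n \<in> S" "f \<longlonglongrightarrow> x"
    by (auto simp: closure_sequential)
  have "(\<lambda>n. c *\<^sub>R f n) \<longlonglongrightarrow> c *\<^sub>R x"
    using f(2) by (intro tendsto_intros)
  then show "c *\<^sub>R x \<in> closure S"
    using f(1) subspace_scale[OF S]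
    unfolding closure_sequential by (intro exI[of _ "\<lambda>n. c *\<^sub>R f n"]) simp
  assume "y \<in> closure S"
  then obtain g where g: "\<And>n. g n \<in> S" "g \<longlonglongrightarrow> y"
    by (auto simp: closure_sequential)
  have "(\<lambda>n. f n + g n) \<longlonglongrightarrow> x + y"
    using f(2) g(2) by (intro tendsto_intros)
  then show "x + y \<in> closure S"
    using f(1) g(1) subspace_add[OF S]
    unfolding closure_sequential by (intro exI[of _ "\<lambda>n. f n + g n"]) simp
qed

lemma complex_subspace_closure:
  assumes S: "complex_subspace S"
  shows "complex_subspace (closure S)"
proof -
  have "(\<lambda>x. \<i> *\<^sub>C x) ` closure S \<subseteq> closure ((\<lambda>x. \<i> *\<^sub>C x) ` S)"
    by (rule closure_bounded_linear_image_subset[OF bounded_linear_scaleC])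
  also have "\<dots> \<subseteq> closure S"
    using S by (intro closure_mono) (auto simp: complex_subspace_def)
  finally show ?thesis
    using S by (auto simp: complex_subspace_def subspace_closure)
qed

context
  fixes S :: "'a::complex_hilbert set"
  assumes S: "complex_subspace S" and cl: "closed S"
begin

text \<open>Riesz representation of \<open>inner x\<close> on \<open>S\<close>. Orthogonality with respect to the real inner product
  gives orthogonality with respect to \<open>cinner\<close> because \<open>S\<close> is closed under \<open>\<i>\<close>.\<close>

lemma orth_proj_char:
  "orth_proj S x \<in> S \<and> (\<forall>y\<in>S. cinner y (x - orth_proj S x) = 0)"
  unfolding orth_proj_def
proof (rule theI', rule ex_ex1I)
  have "\<bar>inner x y\<bar> \<le> norm x * norm y" for y by (rule Cauchy_Schwarz_ineq2)
  then obtain p where "p \<in> closure S" and p: "\<And>y. y \<in> S \<Longrightarrow> inner p y = inner x y"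
    using riesz_on_subspace[OF complex_subspace_imp_subspace[OF S], of "inner x" "norm x"]
    by (auto simp: inner_add_right)
  moreover have "cinner y (x - p) = 0" if "y \<in> S" for y
    using p[OF that] p[of "\<i> *\<^sub>C y"] that S
    by (simp add: cinner_eq_Complex complex_eq_iff inner_diff_right complex_subspace_def
        inner_commute)
  ultimately show "\<exists>p. p \<in> S \<and> (\<forall>y\<in>S. cinner y (x - p) = 0)"
    using cl by auto
next
  fix p q
  assume p: "p \<in> S \<and> (\<forall>y\<in>S. cinner y (x - p) = 0)" and q: "q \<in> S \<and> (\<forall>y\<in>S. cinner y (x - q) = 0)"
  then have "p - q \<in> S" using complex_subspace_imp_subspace[OF S] by (auto intro: subspace_diff)
  then have "inner (p - q) (x - p) = 0" "inner (p - q) (x - q) = 0"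
    using p q by (auto simp: inner_eq_Re_cinner)
  then have "inner (p - q) (p - q) = 0"
    by (simp add: inner_diff_right)
  then show "p = q" by simp
qed

lemma orth_proj_mem: "orth_proj S x \<in> S"
  using orth_proj_char by blast

lemma inner_orth_proj: "y \<in> S \<Longrightarrow> inner y (orth_proj S x) = inner y x"
  using orth_proj_char[of x] by (auto simp: inner_eq_Re_cinner[symmetric] cinner_eq_Complex
      complex_eq_iff inner_diff_right)

lemma orth_proj_unique:
  assumes p: "p \<in> S" and "\<And>y. y \<in> S \<Longrightarrow> inner y p = inner y x"
  shows "orth_proj S x = p"
proof -
  have "orth_proj S x - p \<in> S"
    using complex_subspace_imp_subspace[OF S] orth_proj_mem p by (rule subspace_diff)
  then have "inner (orth_proj S x - p) (orth_proj S x - p) = 0"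
    using assms(2) inner_orth_proj by (simp add: inner_diff_right)
  then show ?thesis by simp
qed

lemma orth_proj_eq_self: "x \<in> S \<Longrightarrow> orth_proj S x = x"
  by (rule orth_proj_unique) simp_all

lemma orth_proj_add: "orth_proj S (x + y) = orth_proj S x + orth_proj S y"
  by (rule orth_proj_unique)
    (auto simp: inner_add_right inner_orth_proj intro: subspace_add[OF complex_subspace_imp_subspace[OF S]] orth_proj_mem)

lemma orth_proj_i_scaleC: "orth_proj S (\<i> *\<^sub>C x) = \<i> *\<^sub>C orth_proj S x"
proof (rule orth_proj_unique)
  show "\<i> *\<^sub>C orth_proj S x \<in> S"
    using S orth_proj_mem by (simp add: complex_subspace_def)
  fix y assume "y \<in> S"
  then have "inner (\<i> *\<^sub>C y) (orth_proj S x) = inner (\<i> *\<^sub>C y) x"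
    using S by (intro inner_orth_proj) (simp add: complex_subspace_def)
  then show "inner y (\<i> *\<^sub>C orth_proj S x) = inner y (\<i> *\<^sub>C x)"
    by (simp add: inner_i_scaleC_left)
qed

lemma orth_proj_scaleR: "orth_proj S (r *\<^sub>R x) = r *\<^sub>R orth_proj S x"
  by (rule orth_proj_unique)
    (auto simp: inner_orth_proj intro: subspace_scale[OF complex_subspace_imp_subspace[OF S]] orth_proj_mem)

lemma norm_orth_proj_le: "norm (orth_proj S x) \<le> norm x"
proof -
  have "(norm (orth_proj S x))\<^sup>2 = inner (orth_proj S x) x"
    using inner_orth_proj[OF orth_proj_mem, of x x] by (simp add: power2_norm_eq_inner)
  also have "\<dots> \<le> norm (orth_proj S x) * norm x"
    by (rule norm_cauchy_schwarz)
  finally show ?thesis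
    by (cases "orth_proj S x = 0") (auto simp: power2_eq_square)
qed

lemma zero_ext_mem: "A \<in> positive_ops S \<Longrightarrow> zero_ext S A x \<in> S"
  using orth_proj_mem[of x] by (auto simp: zero_ext_def positive_ops_def bounded_ops_def)

lemma zero_ext_eq: "x \<in> S \<Longrightarrow> zero_ext S A x = A x"
  by (simp add: zero_ext_def orth_proj_eq_self)

lemma zero_ext_positive_op:
  assumes A: "A \<in> positive_ops S"
  shows "zero_ext S A \<in> positive_ops UNIV"
proof -
  have A_S: "A x \<in> S" if "x \<in> S" for x
    using A that by (auto simp: positive_ops_def bounded_ops_def)
  have add: "A (x + y) = A x + A y" if "x \<in> S" "y \<in> S" for x y
    using A that by (auto simp: positive_ops_def bounded_ops_def)
  have sc: "A (c *\<^sub>C x) = c *\<^sub>C A x" if "x \<in> S" for c x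
    using A that by (auto simp: positive_ops_def bounded_ops_def)
  have real: "Im (cinner x (A x)) = 0 \<and> 0 \<le> inner x (A x)" if "x \<in> S" for x
    using A that by (auto simp: positive_ops_def complex_nonneg_Reals_iff inner_eq_Re_cinner)
  have "\<exists>K. \<forall>x\<in>S. norm (A x) \<le> K * norm x"
    using A by (simp add: positive_ops_def bounded_ops_def)
  then obtain K where K: "\<And>x. x \<in> S \<Longrightarrow> norm (A x) \<le> K * norm x"
    by blast
  let ?P = "orth_proj S"
  note P = orth_proj_mem
  have i: "A (?P (\<i> *\<^sub>C x)) = \<i> *\<^sub>C A (?P x)" for x
    by (simp add: orth_proj_i_scaleC sc P)
  have "bounded_linear (\<lambda>x. A (?P x))"
  proof (rule bounded_linear_intro[where K = "\<bar>K\<bar>"])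
    show "A (?P (x + y)) = A (?P x) + A (?P y)" for x y
      by (simp add: orth_proj_add add P)
    show "A (?P (r *\<^sub>R x)) = r *\<^sub>R A (?P x)" for r x
      by (simp add: orth_proj_scaleR) (simp add: scaleR_scaleC sc P)
    show "norm (A (?P x)) \<le> norm x * \<bar>K\<bar>" for x
    proof -
      have "norm (A (?P x)) \<le> K * norm (?P x)" using K P by blast
      also have "\<dots> \<le> \<bar>K\<bar> * norm x" using norm_orth_proj_le by (intro mult_mono) auto
      finally show ?thesis by (simp add: mult.commute)
    qed
  qed
  moreover have "inner x (A (?P y)) = inner (A (?P x)) y" for x y
  proof -
    have "inner x (A (?P y)) = inner (?P x) (A (?P y))"
      using inner_orth_proj[OF A_S[OF P], of y x] by (simp add: inner_commute)
    also have "\<dots> = inner (A (?P x)) (?P y)"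
      using S real sc add P
      by (intro symmetric_if_cinner_real[where S = S])
        (auto simp: complex_subspace_def subspace_add)
    also have "\<dots> = inner (A (?P x)) y"
      by (rule inner_orth_proj[OF A_S[OF P]])
    finally show ?thesis .
  qed
  moreover have "0 \<le> inner x (A (?P x))" for x
    using inner_orth_proj[OF A_S[OF P], of x x] real[OF P, of x] by (simp add: inner_commute)
  ultimately show ?thesis
    using i by (simp add: positive_ops_UNIV_iff zero_ext_def o_def)
qed

lemma restrict_positive_op:
  assumes A: "A \<in> positive_ops UNIV" and A_S: "\<And>x. x \<in> S \<Longrightarrow> A x \<in> S"
  shows "restrict A S \<in> positive_ops S"
proof -
  obtain K where "\<And>x. norm (A x) \<le> norm x * K"
    using bounded_linear.bounded[OF positive_opsD(1)[OF A]] by blast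
  then have "\<forall>x\<in>S. norm (restrict A S x) \<le> K * norm x"
    by (simp add: mult.commute)
  moreover have "cinner x (A x) \<in> \<real>\<^sub>\<ge>\<^sub>0" for x
    using A by (auto simp: positive_ops_def)
  ultimately show ?thesis
    using A_S subspace_add[OF complex_subspace_imp_subspace[OF S]] complex_subspace_scaleC[OF S]
    by (auto simp: positive_ops_def bounded_ops_def positive_opsD(3,6)[OF A])
qed

end

lemma positive_op_diff:
  assumes A: "A \<in> positive_ops (UNIV :: 'a::complex_hilbert set)" and B: "B \<in> positive_ops UNIV"
    and le: "\<And>x. inner x (A x) \<le> inner x (B x)"
  shows "(\<lambda>x. B x - A x) \<in> positive_ops UNIV"
  using A B le by (auto simp: positive_ops_UNIV_iff inner_diff_left inner_diff_right
      linear_diff[OF bounded_linear.linear[OF bounded_linear_scaleC]] intro: bounded_linear_sub)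

lemma restrict_positive_contraction:
  assumes S: "complex_subspace S" "closed S"
    and A: "A \<in> positive_ops (UNIV :: 'a::complex_hilbert set)" and A_S: "\<And>x. x \<in> S \<Longrightarrow> A x \<in> S"
    and le: "\<And>x. inner x (A x) \<le> (norm x)\<^sup>2"
  shows "restrict A S \<in> positive_contractions S"
proof -
  have "(\<lambda>x. id x - A x) \<in> positive_ops UNIV"
    using le by (intro positive_op_diff A id_positive_op) (simp add: power2_norm_eq_inner)
  then have "restrict (\<lambda>x. x - A x) S \<in> positive_ops S"
    using S A_S subspace_diff[OF complex_subspace_imp_subspace[OF S(1)]]
    by (intro restrict_positive_op) auto
  moreover have "restrict (\<lambda>x. x - restrict A S x) S = restrict (\<lambda>x. x - A x) S"
    by auto
  ultimately show ?thesis
    using restrict_positive_op[OF S A A_S]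
    by (simp only: positive_contractions_def mem_Collect_eq)
qed

subsection \<open>Douglas factorization\<close>

text \<open>The adjoint with respect to the real inner product.\<close>

lemma adjoint_exists:
  fixes C :: "'a::complex_hilbert \<Rightarrow> 'a"
  assumes C: "linear C" and le: "\<And>x. norm (C x) \<le> norm x"
  obtains C' where "linear C'" "\<And>x. norm (C' x) \<le> norm x" "\<And>x y. inner (C' x) y = inner x (C y)"
proof -
  have "\<exists>u. \<forall>y. inner u y = inner x (C y)" for x
  proof -
    have "\<bar>inner x (C y)\<bar> \<le> norm x * norm y" for y
      using Cauchy_Schwarz_ineq2[of x "C y"] mult_left_mono[OF le[of y] norm_ge_zero[of x]]
      by linarith
    then obtain u where "\<And>y. y \<in> UNIV \<Longrightarrow> inner u y = inner x (C y)"
      using riesz_on_subspace[OF subspace_UNIV, of "\<lambda>y. inner x (C y)" "norm x"]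
      by (auto simp: linear_add[OF C] linear_scale[OF C] inner_add_right)
    then show ?thesis by auto
  qed
  then obtain C' where C': "\<And>x y. inner (C' x) y = inner x (C y)" by metis
  have "linear C'"
    by (rule linearI; rule vector_eq_rdot[THEN iffD1]) (simp_all add: C' inner_add_left)
  moreover have "norm (C' x) \<le> norm x" for x
  proof (rule ccontr)
    assume less: "\<not> norm (C' x) \<le> norm x"
    have "norm (C' x) * norm (C' x) = inner x (C (C' x))"
      by (simp add: C'[symmetric] dot_square_norm power2_eq_square)
    also have "\<dots> \<le> norm x * norm (C' x)"
      using norm_cauchy_schwarz[of x "C (C' x)"] mult_left_mono[OF le[of "C' x"] norm_ge_zero[of x]]
      by linarith
    finally show False using less norm_ge_zero[of x] by (simp add: mult_le_cancel_right)
  qed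
  ultimately show thesis using C' by (rule that)
qed

text \<open>For positive \<open>R\<close> and \<open>Q\<close> with \<open>Q\<^sup>2 \<le> R\<^sup>2\<close>, the vector \<open>C z\<close> represents the functional
  \<open>R x \<mapsto> inner z (Q x)\<close> on the range of \<open>R\<close>.\<close>

lemma Douglas_factorization:
  fixes R Q :: "'a::complex_hilbert \<Rightarrow> 'a"
  assumes R: "R \<in> positive_ops UNIV" and Q: "Q \<in> positive_ops UNIV"
    and le: "\<And>x. norm (Q x) \<le> norm (R x)"
  obtains C where "linear C" "\<And>z. C (\<i> *\<^sub>C z) = \<i> *\<^sub>C C z" "\<And>z. norm (C z) \<le> norm z"
    "\<And>z. C z \<in> closure (range R)" "\<And>z. R (C z) = Q z"
proof -
  note R' = positive_opsD[OF R] and Q' = positive_opsD[OF Q]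
  have L: "subspace (range R)"
    by (rule linear_subspace_image[OF R'(2) subspace_UNIV])
  \<comment> \<open>a preimage under \<open>R\<close>; its image under \<open>Q\<close> does not depend on the choice\<close>
  define pre where "pre u = (SOME x. R x = u)" for u
  have pre: "Q (pre (R x)) = Q x" for x
  proof -
    have "R (pre (R x)) = R x" unfolding pre_def by (rule someI) simp
    then have "norm (Q (pre (R x) - x)) \<le> 0"
      using le[of "pre (R x) - x"] by (simp add: R'(7))
    then show ?thesis by (simp add: Q'(7))
  qed
  have "\<exists>u. u \<in> closure (range R) \<and> (\<forall>x. inner u (R x) = inner z (Q x))" for z
  proof -
    have "\<bar>inner z (Q x)\<bar> \<le> norm z * norm (R x)" for x
      using Cauchy_Schwarz_ineq2[of z "Q x"] mult_left_mono[OF le[of x] norm_ge_zero[of z]]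
      by linarith
    then have f_bound: "\<bar>inner z (Q (pre u))\<bar> \<le> norm z * norm u" if "u \<in> range R" for u
      using that by (auto simp: pre)
    have f_add: "inner z (Q (pre (u + v))) = inner z (Q (pre u)) + inner z (Q (pre v))"
      if "u \<in> range R" "v \<in> range R" for u v
      using that by (auto simp: pre R'(6)[symmetric] Q'(6) inner_add_right)
    have f_scale: "inner z (Q (pre (c *\<^sub>R u))) = c * inner z (Q (pre u))" if "u \<in> range R" for c u
      using that by (auto simp: pre R'(8)[symmetric] Q'(8))
    show ?thesis
    proof (rule riesz_on_subspace[where f = "\<lambda>u. inner z (Q (pre u))", OF L f_add f_scale f_bound])
      fix u
      assume u: "u \<in> closure (range R)"
        and eq: "\<And>x. x \<in> range R \<Longrightarrow> inner u x = inner z (Q (pre x))"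
      have "inner u (R x) = inner z (Q x)" for x
        using eq[OF rangeI, of x] by (simp only: pre)
      with u show "\<exists>u. u \<in> closure (range R) \<and> (\<forall>x. inner u (R x) = inner z (Q x))"
        by (intro exI[of _ u] conjI allI)
    qed
  qed
  then obtain C where C_mem: "\<And>z. C z \<in> closure (range R)"
    and C: "\<And>z x. inner (C z) (R x) = inner z (Q x)" by metis
  have cl: "complex_subspace (closure (range R))"
    using L by (intro complex_subspace_closure)
      (auto simp: complex_subspace_def R'(3)[symmetric])
  then have cl': "subspace (closure (range R))" by (simp add: complex_subspace_def)
  have C_eq: "C z = u" if u: "u \<in> closure (range R)" and "\<And>x. inner u (R x) = inner z (Q x)" for z u
  proof -
    have "C z - u \<in> closure (range R)" using cl' C_mem u by (rule subspace_diff)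
    moreover have "inner (C z - u) v = 0" if v: "v \<in> range R" for v
    proof -
      obtain x where "v = R x" using v by blast
      then show ?thesis by (simp add: inner_diff_left C \<open>\<And>x. inner u (R x) = inner z (Q x)\<close>)
    qed
    ultimately have "C z - u = 0" by (rule eq_0_if_inner_0_on_dense)
    then show ?thesis by simp
  qed
  have "linear C"
  proof (rule linearI)
    show "C (x + y) = C x + C y" for x y
      by (intro C_eq subspace_add[OF cl'] C_mem) (simp add: C inner_add_left)
    show "C (r *\<^sub>R x) = r *\<^sub>R C x" for r x
      by (intro C_eq subspace_scale[OF cl'] C_mem) (simp add: C)
  qed
  moreover have "C (\<i> *\<^sub>C z) = \<i> *\<^sub>C C z" for z
  proof (intro C_eq)
    show "\<i> *\<^sub>C C z \<in> closure (range R)" using cl C_mem by (simp add: complex_subspace_def)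
    show "inner (\<i> *\<^sub>C C z) (R x) = inner (\<i> *\<^sub>C z) (Q x)" for x
      by (simp add: inner_i_scaleC_left R'(3)[symmetric] Q'(3)[symmetric] C)
  qed
  moreover have "norm (C z) \<le> norm z" for z
  proof -
    have "inner (C z) u \<le> norm z * norm u" if u: "u \<in> range R" for u
    proof -
      obtain x where "u = R x" using u by blast
      then show ?thesis
        using norm_cauchy_schwarz[of z "Q x"] mult_left_mono[OF le[of x] norm_ge_zero[of z]] C[of z x]
        by simp
    qed
    then show ?thesis
      by (rule norm_le_if_inner_le_on_dense[OF C_mem[of z]]) simp_all
  qed
  moreover have "R (C z) = Q z" for z
    by (rule vector_eq_rdot[THEN iffD1]) (simp add: R'(4)[symmetric] Q'(4)[symmetric] C)
  ultimately show thesis using C_mem by (intro that)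
qed

subsection \<open>Operators below a positive operator\<close>

lemma support_space_subspace:
  assumes "T \<in> positive_ops (UNIV :: 'a::complex_hilbert set)"
  shows "complex_subspace (support_space T)"
proof -
  note R = positive_opsD[OF op_sqrt_positive[OF assms]]
  have "subspace (range (op_sqrt T))" by (rule linear_subspace_image[OF R(2) subspace_UNIV])
  then show ?thesis
    unfolding support_space_def
    by (intro complex_subspace_closure) (auto simp: complex_subspace_def R(3)[symmetric])
qed

lemma closed_support_space: "closed (support_space T)"
  by (simp add: support_space_def)

lemma op_sqrt_in_support_space: "op_sqrt T x \<in> support_space T"
  using closure_subset by (force simp: support_space_def)

text \<open>The operator \<open>A\<close> with \<open>D = op_sqrt T \<circ> A \<circ> op_sqrt T\<close> is \<open>C \<circ> C'\<close>, where
  \<open>op_sqrt D = op_sqrt T \<circ> C\<close> is the Douglas factorization and \<open>C'\<close> is the adjoint of \<open>C\<close>.\<close>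

lemma positive_op_le_derivative:
  fixes T D :: "'a::complex_hilbert \<Rightarrow> 'a"
  assumes T: "T \<in> positive_ops UNIV" and D: "D \<in> positive_ops UNIV"
    and le: "\<And>x. inner x (D x) \<le> inner x (T x)"
  obtains A where "A \<in> positive_ops UNIV" "\<And>x. A x \<in> support_space T"
    "\<And>x. inner x (A x) \<le> (norm x)\<^sup>2" "\<And>x. op_sqrt T (A (op_sqrt T x)) = D x"
proof -
  let ?R = "op_sqrt T" and ?Q = "op_sqrt D"
  note R = op_sqrt_positive[OF T] and Q = op_sqrt_positive[OF D]
  have "norm (?Q x) \<le> norm (?R x)" for x
    using le[of x] by (simp add: norm_le inner_op_sqrt_op_sqrt T D)
  then obtain C where C: "linear C" "\<And>z. C (\<i> *\<^sub>C z) = \<i> *\<^sub>C C z" "\<And>z. norm (C z) \<le> norm z"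
    "\<And>z. C z \<in> closure (range ?R)" "\<And>z. ?R (C z) = ?Q z"
    using Douglas_factorization[OF R Q] by blast
  obtain C' where C': "linear C'" "\<And>x. norm (C' x) \<le> norm x" "\<And>x y. inner (C' x) y = inner x (C y)"
    using adjoint_exists[OF C(1,3)] by blast
  have C'_i: "C' (\<i> *\<^sub>C x) = \<i> *\<^sub>C C' x" for x
    by (rule vector_eq_rdot[THEN iffD1])
      (simp add: C'(3) inner_i_scaleC_left C(2)[symmetric])
  have C'R: "C' (?R x) = ?Q x" for x
    by (rule vector_eq_rdot[THEN iffD1])
      (simp add: C'(3) positive_opsD(4)[OF R, symmetric] C(5) positive_opsD(4)[OF Q])
  have form: "inner x (C (C' y)) = inner (C' x) (C' y)" for x y
    by (simp add: C'(3))
  show thesis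
  proof (rule that[of "\<lambda>x. C (C' x)"])
    show "(\<lambda>x. C (C' x)) \<in> positive_ops UNIV"
      unfolding positive_ops_UNIV_iff
    proof (intro conjI allI)
      show "bounded_linear (\<lambda>x. C (C' x))"
        by (rule bounded_linear_intro[where K = 1])
          (auto simp: linear_add[OF C(1)] linear_add[OF C'(1)] linear_scale[OF C(1)]
            linear_scale[OF C'(1)] intro: order_trans[OF C(3) C'(2)])
      show "C (C' (\<i> *\<^sub>C x)) = \<i> *\<^sub>C C (C' x)" for x by (simp add: C(2) C'_i)
      show "inner x (C (C' y)) = inner (C (C' x)) y" for x y
        using form[of y x] by (simp add: form inner_commute)
      show "0 \<le> inner x (C (C' x))" for x by (simp add: form)
    qed
    show "C (C' x) \<in> support_space T" for x
      using C(4) by (simp add: support_space_def)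
    show "inner x (C (C' x)) \<le> (norm x)\<^sup>2" for x
      using C'(2)[of x] by (simp add: form dot_square_norm power_mono)
    show "?R (C (C' (?R x))) = D x" for x
      by (simp add: C(5) C'R op_sqrt_op_sqrt[OF D])
  qed
qed

text \<open>Self-adjoint operators on the support of \<open>T\<close> are determined by their compression
  \<open>op_sqrt T \<circ> A \<circ> op_sqrt T\<close>, because \<open>op_sqrt T\<close> is injective on the support with dense
  range there.\<close>

lemma eq_on_support_space:
  fixes T :: "'a::complex_hilbert \<Rightarrow> 'a"
  assumes T: "T \<in> positive_ops UNIV"
    and A: "\<And>x y. x \<in> support_space T \<Longrightarrow> y \<in> support_space T \<Longrightarrow> inner x (A y) = inner (A x) y"
      "\<And>x. x \<in> support_space T \<Longrightarrow> A x \<in> support_space T"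
    and B: "\<And>x y. x \<in> support_space T \<Longrightarrow> y \<in> support_space T \<Longrightarrow> inner x (B y) = inner (B x) y"
      "\<And>x. x \<in> support_space T \<Longrightarrow> B x \<in> support_space T"
    and eq: "\<And>x. op_sqrt T (A (op_sqrt T x)) = op_sqrt T (B (op_sqrt T x))"
    and x: "x \<in> support_space T"
  shows "A x = B x"
proof -
  let ?R = "op_sqrt T"
  note R = positive_opsD[OF op_sqrt_positive[OF T]] and R_mem = op_sqrt_in_support_space[of T]
  have sub: "subspace (support_space T)"
    using support_space_subspace[OF T] by (simp add: complex_subspace_def)
  \<comment> \<open>\<open>op_sqrt T\<close> has dense range in the support, hence is injective there\<close>
  have zero: "v = 0" if "v \<in> support_space T" "\<And>y. inner v (?R y) = 0" for v
  proof (rule eq_0_if_inner_0_on_dense)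
    show "v \<in> closure (range ?R)" using that(1) by (simp add: support_space_def)
    show "inner v x = 0" if "x \<in> range ?R" for x
      using that \<open>\<And>y. inner v (?R y) = 0\<close> by blast
  qed
  have range: "A (?R y) = B (?R y)" for y
  proof -
    have "inner (A (?R y) - B (?R y)) (?R z) = 0" for z
      by (simp add: R(4) R(7) eq)
    then have "A (?R y) - B (?R y) = 0"
      by (intro zero subspace_diff[OF sub] A(2) B(2) R_mem)
    then show ?thesis by simp
  qed
  have "inner (A x - B x) (?R y) = 0" for y
    using x R_mem[of y] by (simp add: inner_diff_left A(1)[symmetric] B(1)[symmetric] range)
  then have "A x - B x = 0"
    using x by (intro zero subspace_diff[OF sub] A(2) B(2))
  then show ?thesis by simp
qed

proposition operator_derivatives_unique_existence:
  fixes T :: "'a::complex_hilbert \<Rightarrow> 'a" and D :: "nat \<Rightarrow> 'a \<Rightarrow> 'a"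
  assumes T: "T \<in> positive_ops UNIV" and D: "\<And>j. j < m \<Longrightarrow> D j \<in> positive_ops UNIV"
    and sum: "\<And>x. (\<Sum>j<m. D j x) = T x"
  shows "\<exists>!A. A \<in> {..<m} \<rightarrow>\<^sub>E positive_contractions (support_space T) \<and>
    (\<forall>x\<in>support_space T. (\<Sum>j<m. A j x) = x) \<and>
    (\<forall>j<m. D j = op_sqrt T \<circ> zero_ext (support_space T) (A j) \<circ> op_sqrt T)"
proof (rule ex_ex1I)
  let ?R = "op_sqrt T" and ?H = "support_space T"
  note R = positive_opsD[OF op_sqrt_positive[OF T]] and R_mem = op_sqrt_in_support_space[of T]
  note H = support_space_subspace[OF T] closed_support_space[of T]
  have sub: "subspace ?H" using H(1) by (simp add: complex_subspace_def)
  have le: "inner x (D j x) \<le> inner x (T x)" if "j < m" for j x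
  proof -
    have "inner x (D j x) \<le> (\<Sum>j<m. inner x (D j x))"
      using that by (intro member_le_sum) (auto simp: positive_opsD(5)[OF D])
    then show ?thesis by (simp add: sum[symmetric] inner_sum_right)
  qed
  have "\<forall>j. \<exists>A. j < m \<longrightarrow> A \<in> positive_ops UNIV \<and> (\<forall>x. A x \<in> ?H) \<and>
      (\<forall>x. inner x (A x) \<le> (norm x)\<^sup>2) \<and> (\<forall>x. ?R (A (?R x)) = D j x)"
  proof (intro allI)
    fix j
    show "\<exists>A. j < m \<longrightarrow> A \<in> positive_ops UNIV \<and> (\<forall>x. A x \<in> ?H) \<and>
      (\<forall>x. inner x (A x) \<le> (norm x)\<^sup>2) \<and> (\<forall>x. ?R (A (?R x)) = D j x)"
    proof (cases "j < m")
      case True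
      show ?thesis
        by (rule positive_op_le_derivative[OF T D[OF True] le[OF True]]) auto
    qed simp
  qed
  from choice[OF this] obtain A where A: "\<And>j. j < m \<Longrightarrow> A j \<in> positive_ops UNIV"
    "\<And>j x. j < m \<Longrightarrow> A j x \<in> ?H" "\<And>j x. j < m \<Longrightarrow> inner x (A j x) \<le> (norm x)\<^sup>2"
    "\<And>j x. j < m \<Longrightarrow> ?R (A j (?R x)) = D j x"
    by blast
  have "(\<Sum>j<m. A j x) = x" if "x \<in> ?H" for x
  proof (rule eq_on_support_space[OF T, where A = "\<lambda>x. \<Sum>j<m. A j x" and B = "\<lambda>x. x"])
    show "inner u (\<Sum>j<m. A j v) = inner (\<Sum>j<m. A j u) v" for u v
      by (simp add: inner_sum_left inner_sum_right positive_opsD(4)[OF A(1)])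
    show "(\<Sum>j<m. A j u) \<in> ?H" for u
      using A(2) by (intro subspace_sum[OF sub]) auto
    show "?R (\<Sum>j<m. A j (?R u)) = ?R (?R u)" for u
      by (simp add: linear_sum[OF R(2)] A(4) sum op_sqrt_op_sqrt[OF T])
  qed (use that in auto)
  moreover have "D j = ?R \<circ> zero_ext ?H (restrict (A j) ?H) \<circ> ?R" if "j < m" for j
    using that R_mem by (auto simp: zero_ext_eq[OF H] A(4))
  moreover have "restrict (A j) ?H \<in> positive_contractions ?H" if "j < m" for j
    using that A by (intro restrict_positive_contraction H)
  ultimately show "\<exists>A. A \<in> {..<m} \<rightarrow>\<^sub>E positive_contractions ?H \<and>
      (\<forall>x\<in>?H. (\<Sum>j<m. A j x) = x) \<and> (\<forall>j<m. D j = ?R \<circ> zero_ext ?H (A j) \<circ> ?R)"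
    by (intro exI[of _ "\<lambda>j\<in>{..<m}. restrict (A j) ?H"]) auto
next
  let ?R = "op_sqrt T" and ?H = "support_space T"
  note H = support_space_subspace[OF T] closed_support_space[of T]
  fix A B
  assume A: "A \<in> {..<m} \<rightarrow>\<^sub>E positive_contractions ?H \<and> (\<forall>x\<in>?H. (\<Sum>j<m. A j x) = x) \<and>
      (\<forall>j<m. D j = ?R \<circ> zero_ext ?H (A j) \<circ> ?R)"
    and B: "B \<in> {..<m} \<rightarrow>\<^sub>E positive_contractions ?H \<and> (\<forall>x\<in>?H. (\<Sum>j<m. B j x) = x) \<and>
      (\<forall>j<m. D j = ?R \<circ> zero_ext ?H (B j) \<circ> ?R)"
  show "A = B"
  proof (rule PiE_ext)
    show "A \<in> {..<m} \<rightarrow>\<^sub>E positive_contractions ?H" "B \<in> {..<m} \<rightarrow>\<^sub>E positive_contractions ?H"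
      using A B by auto
    fix j assume "j \<in> {..<m}"
    then have j: "j < m" by simp
    have Aj: "A j \<in> positive_ops ?H" and Bj: "B j \<in> positive_ops ?H"
      using A B j by (auto simp: positive_contractions_def)
    have "?R (zero_ext ?H (A j) (?R x)) = ?R (zero_ext ?H (B j) (?R x))" for x
    proof -
      have "?R \<circ> zero_ext ?H (A j) \<circ> ?R = ?R \<circ> zero_ext ?H (B j) \<circ> ?R"
        using A B j by (auto simp del: comp_apply)
      then show ?thesis by (simp add: fun_eq_iff)
    qed
    then have "zero_ext ?H (A j) x = zero_ext ?H (B j) x" if "x \<in> ?H" for x
      by (intro eq_on_support_space[OF T, where A = "zero_ext ?H (A j)" and B = "zero_ext ?H (B j)"]
          positive_opsD(4)[OF zero_ext_positive_op[OF H]] zero_ext_mem[OF H] Aj Bj that)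
    then show "A j = B j"
      using Aj Bj by (intro PiE_ext[of _ ?H "\<lambda>_. ?H"])
        (auto simp: zero_ext_eq[OF H] positive_ops_def bounded_ops_def)
  qed
qed

text \<open>In the converse direction, compressing with \<open>op_sqrt T\<close> preserves positivity and turns a
  partition of the identity of the support into a partition of \<open>T\<close>.\<close>

lemma positive_op_compression:
  fixes T :: "'a::complex_hilbert \<Rightarrow> 'a"
  assumes T: "T \<in> positive_ops UNIV" and A: "A \<in> positive_ops (support_space T)"
  shows "op_sqrt T \<circ> zero_ext (support_space T) A \<circ> op_sqrt T \<in> positive_ops UNIV"
proof -
  let ?Z = "zero_ext (support_space T) A"
  have Z: "?Z \<in> positive_ops UNIV"
    by (rule zero_ext_positive_op[OF support_space_subspace[OF T] closed_support_space A])
  note R = positive_opsD[OF op_sqrt_positive[OF T]] and Z' = positive_opsD[OF Z]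
  show ?thesis
    unfolding positive_ops_UNIV_iff o_def
  proof (intro conjI allI)
    show "bounded_linear (\<lambda>x. op_sqrt T (?Z (op_sqrt T x)))"
      by (intro bounded_linear_compose[OF R(1)] bounded_linear_compose[OF Z'(1)] R(1))
    show "op_sqrt T (?Z (op_sqrt T (\<i> *\<^sub>C x))) = \<i> *\<^sub>C op_sqrt T (?Z (op_sqrt T x))" for x
      by (simp add: R(3) Z'(3))
    show "inner x (op_sqrt T (?Z (op_sqrt T y))) = inner (op_sqrt T (?Z (op_sqrt T x))) y" for x y
      by (simp only: R(4) Z'(4))
    show "0 \<le> inner x (op_sqrt T (?Z (op_sqrt T x)))" for x
      using Z'(5)[of "op_sqrt T x"] by (simp only: R(4))
  qed
qed

lemma sum_compressions:
  fixes T :: "'a::complex_hilbert \<Rightarrow> 'a"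
  assumes T: "T \<in> positive_ops UNIV"
    and sum: "\<And>x. x \<in> support_space T \<Longrightarrow> (\<Sum>j<m. A j x) = x"
  shows "(\<Sum>j<m. op_sqrt T (zero_ext (support_space T) (A j) (op_sqrt T x))) = T x"
proof -
  note H = support_space_subspace[OF T] closed_support_space[of T]
  have "(\<Sum>j<m. op_sqrt T (zero_ext (support_space T) (A j) (op_sqrt T x))) =
      op_sqrt T (\<Sum>j<m. A j (op_sqrt T x))"
    by (simp add: zero_ext_eq[OF H] op_sqrt_in_support_space
        linear_sum[OF positive_opsD(2)[OF op_sqrt_positive[OF T]]])
  also have "\<dots> = T x"
    by (simp add: sum op_sqrt_in_support_space op_sqrt_op_sqrt[OF T])
  finally show ?thesis .
qed


section \<open>Cylinder sets and set functions on the sequence space\<close>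

text \<open>Countable additivity for set functions with values in a normed space, so that differences and
  other linear combinations of finite measures are covered. Values outside \<open>sets M\<close> are
  irrelevant.\<close>

definition sigma_additive :: "'b measure \<Rightarrow> ('b set \<Rightarrow> 'c::real_normed_vector) \<Rightarrow> bool" where
  "sigma_additive M \<nu> \<longleftrightarrow> (\<forall>B :: nat \<Rightarrow> 'b set. range B \<subseteq> sets M \<longrightarrow> disjoint_family B \<longrightarrow>
     (\<lambda>n. \<nu> (B n)) sums \<nu> (\<Union>n. B n))"

lemma sigma_additiveD:
  "sigma_additive M \<nu> \<Longrightarrow> range B \<subseteq> sets M \<Longrightarrow> disjoint_family B \<Longrightarrow> (\<lambda>n. \<nu> (B n)) sums \<nu> (\<Union>n. B n)"
  by (simp add: sigma_additive_def)

lemma sigma_additive_empty: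
  assumes "sigma_additive M \<nu>"
  shows "\<nu> {} = 0"
proof -
  have "(\<lambda>n::nat. \<nu> {}) sums \<nu> (\<Union>n::nat. {})"
    using sigma_additiveD[OF assms, of "\<lambda>_. {}"] by (simp add: disjoint_family_on_def)
  then have "(\<lambda>n::nat. \<nu> {}) \<longlonglongrightarrow> 0"
    by (intro summable_LIMSEQ_zero) (rule sums_summable)
  then show ?thesis by (simp add: LIMSEQ_const_iff)
qed

lemma sigma_additive_finite_Union:
  assumes \<nu>: "sigma_additive M \<nu>" and B: "\<And>j. j < m \<Longrightarrow> B j \<in> sets M"
    and disj: "disjoint_family_on B {..<m::nat}"
  shows "\<nu> (\<Union>j<m. B j) = (\<Sum>j<m. \<nu> (B j))"
proof -
  \<comment> \<open>the family padded with empty sets\<close>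
  define C where "C j = (if j < m then B j else {})" for j
  have "range C \<subseteq> sets M" using B by (auto simp: C_def)
  moreover have "disjoint_family C"
    using disj by (auto simp: C_def disjoint_family_on_def)
  ultimately have "(\<lambda>n. \<nu> (C n)) sums \<nu> (\<Union>n. C n)"
    by (rule sigma_additiveD[OF \<nu>])
  moreover have "(\<lambda>n. \<nu> (C n)) sums (\<Sum>j<m. \<nu> (C j))"
    by (rule sums_finite) (auto simp: C_def sigma_additive_empty[OF \<nu>])
  moreover have "(\<Union>n. C n) = (\<Union>j<m. B j)" by (auto simp: C_def split: if_splits)
  moreover have "(\<Sum>j<m. \<nu> (C j)) = (\<Sum>j<m. \<nu> (B j))" by (simp add: C_def)
  ultimately show ?thesis by (simp add: sums_iff)
qed

lemma sigma_additive_add: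
  "sigma_additive M \<nu> \<Longrightarrow> sigma_additive M \<mu> \<Longrightarrow> sigma_additive M (\<lambda>B. \<nu> B + \<mu> B)"
  by (simp add: sigma_additive_def sums_add)

lemma sigma_additive_diff:
  "sigma_additive M \<nu> \<Longrightarrow> sigma_additive M \<mu> \<Longrightarrow> sigma_additive M (\<lambda>B. \<nu> B - \<mu> B)"
  by (simp add: sigma_additive_def sums_diff)

lemma sigma_additive_cmult:
  fixes \<nu> :: "'b set \<Rightarrow> real"
  shows "sigma_additive M \<nu> \<Longrightarrow> sigma_additive M (\<lambda>B. c * \<nu> B)"
  by (simp add: sigma_additive_def sums_mult)

lemma sigma_additive_measure:
  assumes "finite_measure N" "sets N = sets M"
  shows "sigma_additive M (measure N)"
proof -
  interpret finite_measure N by fact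
  show ?thesis
    using assms(2) finite_measure_UNION by (auto simp: sigma_additive_def)
qed

subsection \<open>Cylinders\<close>

lemma cylinder_Nil: "cylinder m [] = space (Omega m)"
  by (simp add: cylinder_def)

lemma cylinder_snoc: "cylinder m (w @ [j]) = {x \<in> cylinder m w. x (length w) = j}"
  by (auto simp: cylinder_def nth_append less_Suc_eq)

lemma cylinder_eq_Union: "cylinder m w = (\<Union>j<m. cylinder m (w @ [j]))"
  by (auto simp: cylinder_snoc) (auto simp: cylinder_def space_Omega)

lemma disjoint_cylinder_snoc: "disjoint_family_on (\<lambda>j. cylinder m (w @ [j])) J"
  by (auto simp: disjoint_family_on_def cylinder_snoc)

lemma cylinder_in_sets: "cylinder m w \<in> sets (Omega m)"
proof -
  have single: "{x \<in> space (Omega m). x i = a} \<in> sets (Omega m)" for i a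
  proof -
    have "(\<lambda>x. x i) \<in> Omega m \<rightarrow>\<^sub>M count_space {..<m}"
      by (simp add: Omega_def)
    then have "(\<lambda>x. x i) -` ({a} \<inter> {..<m}) \<inter> space (Omega m) \<in> sets (Omega m)"
      by (rule measurable_sets) simp
    also have "(\<lambda>x. x i) -` ({a} \<inter> {..<m}) \<inter> space (Omega m) = {x \<in> space (Omega m). x i = a}"
      unfolding space_Omega by blast
    finally show ?thesis .
  qed
  show ?thesis
  proof (induction w rule: rev_induct)
    case (snoc j w)
    have "cylinder m (w @ [j]) = cylinder m w \<inter> {x \<in> space (Omega m). x (length w) = j}"
      by (auto simp: cylinder_snoc) (auto simp: cylinder_def)
    then show ?case using snoc single by auto
  qed (simp add: cylinder_Nil)
qed

text \<open>Two cylinders are nested or disjoint, according to whether one word is a prefix of the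
  other.\<close>

lemma cylinder_Int:
  assumes "length v \<le> length w"
  shows "cylinder m v \<inter> cylinder m w = (if take (length v) w = v then cylinder m w else {})"
proof (cases "take (length v) w = v")
  case True
  then have "v ! i = w ! i" if "i < length v" for i
    using that by (metis nth_take)
  then show ?thesis using True assms by (auto simp: cylinder_def)
next
  case False
  then obtain i where "i < length v" "v ! i \<noteq> w ! i"
    using assms by (metis length_take min.absorb2 nth_equalityI nth_take)
  then show ?thesis using False assms by (auto simp: cylinder_def)
qed

lemma Int_stable_cylinders: "Int_stable (insert {} (cylinder m ` lists {..<m}))"
proof (rule Int_stableI)
  fix A B
  assume "A \<in> insert {} (cylinder m ` lists {..<m})" "B \<in> insert {} (cylinder m ` lists {..<m})"
  then consider "A = {} \<or> B = {}"
    | v w where "v \<in> lists {..<m}" "w \<in> lists {..<m}" "A = cylinder m v" "B = cylinder m w"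
    by auto
  then show "A \<inter> B \<in> insert {} (cylinder m ` lists {..<m})"
  proof cases
    case 2
    then show ?thesis
      using cylinder_Int[of v w m] cylinder_Int[of w v m]
      by (cases "length v \<le> length w") (auto simp: Int_commute)
  qed auto
qed

lemma cylinders_subset_Pow: "insert {} (cylinder m ` lists {..<m}) \<subseteq> Pow (space (Omega m))"
  by (auto simp: cylinder_def)

lemma sets_Omega_eq_sigma_cylinders:
  "sets (Omega m) = sigma_sets (space (Omega m)) (insert {} (cylinder m ` lists {..<m}))"
  (is "_ = sigma_sets ?\<Omega> ?G")
proof
  show "sigma_sets ?\<Omega> ?G \<subseteq> sets (Omega m)"
    using cylinder_in_sets by (intro sets.sigma_sets_subset) auto
  interpret sigma_algebra ?\<Omega> "sigma_sets ?\<Omega> ?G"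
    using cylinders_subset_Pow by (rule sigma_algebra_sigma_sets)
  have "{f \<in> \<Pi>\<^sub>E i\<in>UNIV. space (count_space {..<m}). f i \<in> A} \<in> sigma_sets ?\<Omega> ?G"
    for i :: nat and A
  proof -
    \<comment> \<open>the words that fix the first \<open>i + 1\<close> letters, the last of them in \<open>A\<close>\<close>
    let ?W = "{w. set w \<subseteq> {..<m} \<and> length w = Suc i \<and> w ! i \<in> A}"
    have "{f \<in> \<Pi>\<^sub>E i\<in>UNIV. space (count_space {..<m}). f i \<in> A} = (\<Union>w\<in>?W. cylinder m w)"
    proof (intro equalityI subsetI)
      fix x assume x: "x \<in> {f \<in> \<Pi>\<^sub>E i\<in>UNIV. space (count_space {..<m}). f i \<in> A}"
      then have "map x [0..<Suc i] \<in> ?W" "x \<in> cylinder m (map x [0..<Suc i])"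
        by (auto simp: cylinder_def space_Omega simp del: upt_Suc)
      then show "x \<in> (\<Union>w\<in>?W. cylinder m w)" by blast
    qed (auto simp: cylinder_def space_Omega)
    moreover have "finite ?W"
      by (rule finite_subset[OF _ finite_lists_length_eq[of "{..<m}" "Suc i"]]) auto
    moreover have "cylinder m w \<in> sigma_sets ?\<Omega> ?G" if "w \<in> ?W" for w
      using that by (intro sigma_sets.Basic) auto
    ultimately show ?thesis by (auto intro!: finite_UN)
  qed
  then have "sigma_sets ?\<Omega> {{f \<in> \<Pi>\<^sub>E i\<in>UNIV. space (count_space {..<m}). f i \<in> A} |i A.
      i \<in> UNIV \<and> A \<in> sets (count_space {..<m})} \<subseteq> sigma_sets ?\<Omega> ?G"
    by (intro sigma_sets_mono) auto
  then show "sets (Omega m) \<subseteq> sigma_sets ?\<Omega> ?G"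
    by (simp only: Omega_def sets_PiM_single space_PiM)
qed

text \<open>By Dynkin's theorem, since the cylinders form an intersection-stable generator that contains
  the whole space.\<close>

lemma sigma_additive_eq_0_if_cylinders:
  assumes \<nu>: "sigma_additive (Omega m) \<nu>" and cyl: "\<And>w. w \<in> lists {..<m} \<Longrightarrow> \<nu> (cylinder m w) = 0"
    and B: "B \<in> sets (Omega m)"
  shows "\<nu> B = 0"
proof -
  note eq = sets_Omega_eq_sigma_cylinders[symmetric, of m]
  have space: "\<nu> (space (Omega m)) = 0"
    using cyl[of "[]"] by (simp add: cylinder_Nil)
  have "B \<in> sigma_sets (space (Omega m)) (insert {} (cylinder m ` lists {..<m}))"
    using B sets_Omega_eq_sigma_cylinders by simp
  with Int_stable_cylinders cylinders_subset_Pow show ?thesis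
  proof (induction rule: sigma_sets_induct_disjoint)
    case (basic A)
    then show ?case using cyl sigma_additive_empty[OF \<nu>] by auto
  next
    case empty
    show ?case by (rule sigma_additive_empty[OF \<nu>])
  next
    case (compl A)
    then have A: "A \<in> sets (Omega m)" by (simp add: eq)
    define C where "C j = (if j = 0 then A else space (Omega m) - A)" for j :: nat
    have "\<nu> (\<Union>j<2. C j) = (\<Sum>j<2. \<nu> (C j))"
      using A by (intro sigma_additive_finite_Union[OF \<nu>])
        (auto simp: C_def disjoint_family_on_def)
    moreover have "(\<Union>j<2. C j) = space (Omega m)"
      using sets.sets_into_space[OF A] by (auto simp: C_def numeral_2_eq_2 lessThan_Suc)
    ultimately show ?case
      using space compl by (simp add: C_def numeral_2_eq_2)
  next
    case (union A)
    have "(\<lambda>n. \<nu> (A n)) sums \<nu> (\<Union>n. A n)"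
      using union by (intro sigma_additiveD[OF \<nu>]) (auto simp: eq)
    then have "(\<lambda>n::nat. 0) sums \<nu> (\<Union>n. A n)" using union by simp
    then show ?case by (simp add: sums_iff)
  qed
qed

subsection \<open>Measures with prescribed cylinder masses\<close>

text \<open>A consistent family of masses on words is realized by nested half-open intervals: the
  interval of \<open>w\<close> has length \<open>p w\<close> and is partitioned, from left to right, by the intervals of the
  words \<open>w @ [j]\<close>. The measure is the image of Lebesgue measure under the map that sends a point
  to the sequence of letters whose intervals contain it.\<close>

proposition measure_with_cylinder_masses:
  fixes p :: "nat list \<Rightarrow> real"
  assumes nonneg: "\<And>w. w \<in> lists {..<m} \<Longrightarrow> 0 \<le> p w"
    and sum: "\<And>w. w \<in> lists {..<m} \<Longrightarrow> (\<Sum>j<m. p (w @ [j])) = p w"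
  obtains N where "finite_measure N" "sets N = sets (Omega m)"
    "\<And>w. w \<in> lists {..<m} \<Longrightarrow> measure N (cylinder m w) = p w"
proof -
  \<comment> \<open>\<open>l w\<close> is the left endpoint of the interval \<open>I w\<close>\<close>
  define l where "l w = (\<Sum>k<length w. \<Sum>i<w ! k. p (take k w @ [i]))" for w
  define I where "I w = {l w ..< l w + p w}" for w
  have l_snoc: "l (w @ [j]) = l w + (\<Sum>i<j. p (w @ [i]))" for w j
    by (simp add: l_def nth_append)
  have partial_mono: "(\<Sum>i<j. p (w @ [i])) \<le> (\<Sum>i<k. p (w @ [i]))"
    if "w \<in> lists {..<m}" "j \<le> k" "k \<le> m" for w j k
    using that by (intro sum_mono2) (auto intro!: nonneg)
  have I_sub: "I (w @ [j]) \<subseteq> I w" if w: "w \<in> lists {..<m}" and j: "j < m" for w j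
  proof -
    have "0 \<le> (\<Sum>i<j. p (w @ [i]))"
      using partial_mono[OF w, of 0 j] j by simp
    moreover have "(\<Sum>i<Suc j. p (w @ [i])) \<le> p w"
      using partial_mono[OF w, of "Suc j" m] j sum[OF w] by simp
    ultimately show ?thesis by (auto simp: I_def l_snoc)
  qed
  have I_ex: "\<exists>j<m. t \<in> I (w @ [j])" if w: "w \<in> lists {..<m}" and t: "t \<in> I w" for w t
  proof -
    define P where "P j \<longleftrightarrow> t < l w + (\<Sum>i<Suc j. p (w @ [i]))" for j
    have t_m: "t < l w + (\<Sum>i<m. p (w @ [i]))"
      using t sum[OF w] by (simp add: I_def)
    have "m \<noteq> 0" using t_m t by (cases "m = 0") (auto simp: I_def)
    then obtain k where k: "m = Suc k" by (cases m) auto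
    then have "P k" using t_m by (simp add: P_def)
    define j where "j = (LEAST j. P j)"
    have "P j" unfolding j_def using \<open>P k\<close> by (rule LeastI)
    have "j \<le> k" unfolding j_def using \<open>P k\<close> by (rule Least_le)
    have "l w + (\<Sum>i<j. p (w @ [i])) \<le> t"
    proof (cases j)
      case 0
      then show ?thesis using t by (simp add: I_def)
    next
      case (Suc i)
      then have "\<not> P i" unfolding j_def by (intro not_less_Least) simp
      then show ?thesis using Suc by (simp add: P_def not_less)
    qed
    with \<open>P j\<close> \<open>j \<le> k\<close> k show ?thesis
      by (intro exI[of _ j]) (auto simp: P_def I_def l_snoc)
  qed
  have I_unique: "i = j" if w: "w \<in> lists {..<m}" and "i < m" "j < m"
    and t: "t \<in> I (w @ [i])" "t \<in> I (w @ [j])" for w t i j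
  proof -
    have "\<not> a < b" if "b < m" "t \<in> I (w @ [a])" "t \<in> I (w @ [b])" for a b
    proof
      assume "a < b"
      then have "(\<Sum>i<Suc a. p (w @ [i])) \<le> (\<Sum>i<b. p (w @ [i]))"
        using w that by (intro partial_mono) auto
      then show False using that by (auto simp: I_def l_snoc)
    qed
    then show ?thesis using that by (meson linorder_neqE_nat)
  qed
  \<comment> \<open>\<open>X t\<close> is the sequence of letters read off from \<open>t\<close>, and \<open>wd t n\<close> is its prefix of length
    \<open>n\<close>\<close>
  define nxt where "nxt w t = (SOME j. j < m \<and> t \<in> I (w @ [j]))" for w t
  have nxt: "nxt w t < m \<and> t \<in> I (w @ [nxt w t])" if "w \<in> lists {..<m}" "t \<in> I w" for w t
    unfolding nxt_def by (rule someI_ex) (use I_ex[OF that] in blast)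
  define wd where "wd t = rec_nat [] (\<lambda>_ w. w @ [nxt w t])" for t
  define X where "X t n = nxt (wd t n) t" for t n
  have wd_simps: "wd t 0 = []" "wd t (Suc n) = wd t n @ [X t n]" for t n
    by (simp_all add: wd_def X_def)
  have wd_eq_map: "wd t n = map (X t) [0..<n]" for t n
    by (induction n) (simp_all add: wd_simps)
  have wd: "wd t n \<in> lists {..<m} \<and> t \<in> I (wd t n)"
    if t: "t \<in> I []" for t n
  proof (induction n)
    case 0
    show ?case using t by (simp add: wd_simps)
  next
    case (Suc n)
    then have "X t n < m \<and> t \<in> I (wd t n @ [X t n])" unfolding X_def by (intro nxt) auto
    then show ?case using Suc by (simp add: wd_simps)
  qed
  have I_wd: "t \<in> I [] \<and> wd t (length w) = w" if "w \<in> lists {..<m}" "t \<in> I w" for w t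
    using that
  proof (induction w rule: rev_induct)
    case Nil
    then show ?case by (simp add: wd_simps)
  next
    case (snoc j w)
    then have w: "w \<in> lists {..<m}" and j: "j < m" by auto
    then have t: "t \<in> I w" using snoc.prems I_sub by blast
    then have IH: "t \<in> I []" "wd t (length w) = w" using snoc.IH w by auto
    have "X t (length w) = j"
      using nxt[OF w t] snoc.prems(2) j w by (intro I_unique[of w]) (auto simp: X_def IH)
    then show ?case using IH by (simp add: wd_simps)
  qed
  define L where "L = restrict_space lborel (I [])"
  have space_L: "space L = I []" by (simp add: L_def space_restrict_space)
  have I_sets: "I w \<in> sets lborel" for w by (simp add: I_def)
  have X_space: "X t \<in> space (Omega m)" if "t \<in> I []" for t
  proof -
    have "X t n < m" for n
      using wd[OF that, of "Suc n"] by (auto simp: wd_simps)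
    then show ?thesis by (simp add: space_Omega)
  qed
  have vimage: "X -` cylinder m w \<inter> I [] = I w" if w: "w \<in> lists {..<m}" for w
  proof (intro equalityI subsetI)
    fix t assume t: "t \<in> X -` cylinder m w \<inter> I []"
    then have "wd t (length w) = w"
      unfolding wd_eq_map by (intro nth_equalityI) (auto simp: cylinder_def)
    then show "t \<in> I w" using wd[of t "length w"] t by auto
  next
    fix t assume t: "t \<in> I w"
    have t0: "t \<in> I []" and "wd t (length w) = w" using I_wd[OF w t] by auto
    then have "w = map (X t) [0..<length w]" by (simp add: wd_eq_map)
    then have "X t i = w ! i" if "i < length w" for i
      using that by (metis add_0 nth_map_upt diff_zero)
    then show "t \<in> X -` cylinder m w \<inter> I []"
      using t0 X_space by (auto simp: cylinder_def)
  qed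
  have I_Int: "I w \<subseteq> I []" if "w \<in> lists {..<m}" for w using I_wd that by blast
  have X: "X \<in> L \<rightarrow>\<^sub>M Omega m"
  proof (rule measurable_sigma_sets[OF sets_Omega_eq_sigma_cylinders cylinders_subset_Pow])
    show "X \<in> space L \<rightarrow> space (Omega m)" using X_space by (auto simp: space_L)
    fix y assume "y \<in> insert {} (cylinder m ` lists {..<m})"
    then consider "y = {}" | w where "w \<in> lists {..<m}" "y = cylinder m w" by blast
    then show "X -` y \<inter> space L \<in> sets L"
    proof cases
      case 2
      then show ?thesis
        using I_sets I_Int[OF 2(1)]
        by (simp only: space_L vimage) (simp add: L_def sets_restrict_space_iff)
    qed simp
  qed
  have mass: "emeasure (distr L (Omega m) X) (cylinder m w) = ennreal (p w)"
    if w: "w \<in> lists {..<m}" for w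
  proof -
    have "emeasure (distr L (Omega m) X) (cylinder m w) = emeasure L (I w)"
      by (simp add: emeasure_distr[OF X cylinder_in_sets] space_L vimage[OF w])
    also have "\<dots> = emeasure lborel (I w)"
      unfolding L_def using I_Int[OF w] I_sets by (intro emeasure_restrict_space) auto
    also have "\<dots> = ennreal (p w)"
      using nonneg[OF w] by (simp add: I_def)
    finally show ?thesis .
  qed
  show thesis
  proof (rule that[of "distr L (Omega m) X"])
    show "finite_measure (distr L (Omega m) X)"
      by (rule finite_measureI) (use mass[of "[]"] in \<open>simp add: cylinder_Nil\<close>)
    show "measure (distr L (Omega m) X) (cylinder m w) = p w" if "w \<in> lists {..<m}" for w
      using mass[OF that] nonneg[OF that] by (simp add: measure_def)
  qed simp
qed


section \<open>POVMs and operator-valued word functions\<close>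

lemma povm_in_PiE: "povm M E \<Longrightarrow> E \<in> sets M \<rightarrow>\<^sub>E positive_ops UNIV"
  unfolding povm_def by (rule conjunct1)

lemma povm_positive_op: "povm M E \<Longrightarrow> B \<in> sets M \<Longrightarrow> E B \<in> positive_ops UNIV"
  using povm_in_PiE by (rule PiE_mem)

lemma povm_sigma_additive:
  assumes "povm M E"
  shows "sigma_additive M (\<lambda>B. inner x (E B y))"
  unfolding sigma_additive_def inner_eq_Re_cinner
  using assms by (intro allI impI sums_Re) (simp add: povm_def)

lemma povm_sum_cylinder_snoc:
  assumes E: "povm (Omega m) E"
  shows "(\<Sum>j<m. E (cylinder m (w @ [j])) x) = E (cylinder m w) x"
proof (rule vector_eq_ldot[THEN iffD1], rule allI)
  fix y
  have "inner y (E (\<Union>j<m. cylinder m (w @ [j])) x) = (\<Sum>j<m. inner y (E (cylinder m (w @ [j])) x))"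
    by (rule sigma_additive_finite_Union[OF povm_sigma_additive[OF E] cylinder_in_sets
          disjoint_cylinder_snoc])
  then show "inner y (\<Sum>j<m. E (cylinder m (w @ [j])) x) = inner y (E (cylinder m w) x)"
    by (simp add: inner_sum_right cylinder_eq_Union[symmetric])
qed

text \<open>Uniqueness principle for set functions that need be neither positive nor scalar.\<close>

lemma sigma_additive_eqI:
  assumes "sigma_additive (Omega m) \<nu>" "sigma_additive (Omega m) \<mu>"
    and "\<And>w. w \<in> lists {..<m} \<Longrightarrow> \<nu> (cylinder m w) = \<mu> (cylinder m w)"
    and "B \<in> sets (Omega m)"
  shows "\<nu> B = \<mu> B"
  using sigma_additive_eq_0_if_cylinders[OF sigma_additive_diff[OF assms(1,2)] _ assms(4)] assms(3)
  by simp

lemma povm_unique: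
  assumes E: "povm (Omega m) E" and F: "povm (Omega m) F"
    and eq: "\<And>w. w \<in> lists {..<m} \<Longrightarrow> E (cylinder m w) = F (cylinder m w)"
  shows "E = F"
proof (rule PiE_ext)
  show "E \<in> sets (Omega m) \<rightarrow>\<^sub>E positive_ops UNIV" "F \<in> sets (Omega m) \<rightarrow>\<^sub>E positive_ops UNIV"
    by (rule povm_in_PiE[OF E], rule povm_in_PiE[OF F])
  fix B assume B: "B \<in> sets (Omega m)"
  show "E B = F B"
  proof
    fix y
    have "inner x (E B y) = inner x (F B y)" for x
      by (rule sigma_additive_eqI[OF povm_sigma_additive[OF E] povm_sigma_additive[OF F] _ B])
        (simp only: eq)
    then show "E B y = F B y" by (rule vector_eq_ldot[THEN iffD1, OF allI])
  qed
qed

text \<open>The measure \<open>N x\<close> is to be \<open>B \<mapsto> inner x (E B x)\<close>. It depends quadratically on \<open>x\<close>, since the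
  defining identities of a quadratic form hold on cylinders and both sides are
  \<open>\<sigma>\<close>-additive; polarization and Riesz representation then produce \<open>E B\<close>.\<close>

proposition povm_with_cylinder_values_exists:
  fixes F :: "nat list \<Rightarrow> 'a::complex_hilbert \<Rightarrow> 'a"
  assumes F: "\<And>w. w \<in> lists {..<m} \<Longrightarrow> F w \<in> positive_ops UNIV"
    and Nil: "F [] = id"
    and sum: "\<And>w x. w \<in> lists {..<m} \<Longrightarrow> (\<Sum>j<m. F (w @ [j]) x) = F w x"
  obtains E where "povm (Omega m) E" "\<And>w. w \<in> lists {..<m} \<Longrightarrow> E (cylinder m w) = F w"
proof -
  have "\<exists>N. finite_measure N \<and> sets N = sets (Omega m) \<and>
      (\<forall>w\<in>lists {..<m}. measure N (cylinder m w) = inner x (F w x))" for x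
  proof (rule measure_with_cylinder_masses[of m "\<lambda>w. inner x (F w x)"])
    show "0 \<le> inner x (F w x)" if "w \<in> lists {..<m}" for w
      by (rule positive_opsD(5)[OF F[OF that]])
    show "(\<Sum>j<m. inner x (F (w @ [j]) x)) = inner x (F w x)" if "w \<in> lists {..<m}" for w
      using sum[OF that, of x] by (simp add: inner_sum_right[symmetric])
  qed blast
  then obtain N where N: "\<And>x. finite_measure (N x)" "\<And>x. sets (N x) = sets (Omega m)"
    and N_cyl: "\<And>x w. w \<in> lists {..<m} \<Longrightarrow> measure (N x) (cylinder m w) = inner x (F w x)"
    by metis
  \<comment> \<open>the real part of the sesquilinear form of \<open>E B\<close>, by polarization\<close>
  define s where "s B x y = 1 / 4 * (measure (N (x + y)) B - measure (N (x - y)) B)" for B x y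
  have sa: "sigma_additive (Omega m) (\<lambda>B. s B x y)" for x y
    unfolding s_def by (intro sigma_additive_cmult sigma_additive_diff sigma_additive_measure N)
  have s_cyl: "s (cylinder m w) x y = inner x (F w y)" if w: "w \<in> lists {..<m}" for w x y
    using positive_opsD(4)[OF F[OF w], of x y]
    by (simp add: s_def N_cyl[OF w] positive_opsD(6,7)[OF F[OF w]] inner_add_left inner_add_right
        inner_diff_left inner_diff_right inner_commute[of y])
  have s_sym: "s B x y = s B y x" if "B \<in> sets (Omega m)" for B x y
  proof (rule sigma_additive_eqI[OF sa sa _ that])
    fix w assume w: "w \<in> lists {..<m}"
    show "s (cylinder m w) x y = s (cylinder m w) y x"
      using positive_opsD(4)[OF F[OF w], of x y] by (simp add: s_cyl[OF w] inner_commute)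
  qed
  have s_add: "s B (x + y) z = s B x z + s B y z" if "B \<in> sets (Omega m)" for B x y z
    by (rule sigma_additive_eqI[OF sa sigma_additive_add[OF sa sa] _ that])
      (simp add: s_cyl inner_add_left)
  have s_scale: "s B (c *\<^sub>R x) y = c * s B x y" if "B \<in> sets (Omega m)" for B c x y
    by (rule sigma_additive_eqI[OF sa sigma_additive_cmult[OF sa] _ that]) (simp add: s_cyl)
  have s_i: "s B (\<i> *\<^sub>C x) y = - 1 * s B x (\<i> *\<^sub>C y)" if "B \<in> sets (Omega m)" for B x y
    by (rule sigma_additive_eqI[OF sa sigma_additive_cmult[OF sa] _ that])
      (simp add: s_cyl positive_opsD(3)[OF F] inner_i_scaleC_left)
  have s_self: "s B x x = measure (N x) B" if "B \<in> sets (Omega m)" for B x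
    by (rule sigma_additive_eqI[OF sa sigma_additive_measure[OF N] _ that]) (simp add: s_cyl N_cyl)
  have s_le: "\<bar>s B x y\<bar> \<le> norm y * norm x" if B: "B \<in> sets (Omega m)" for B x y
  proof -
    have mass: "measure (N x) B \<le> (norm x)\<^sup>2" for x
    proof -
      interpret finite_measure "N x" by (rule N)
      have "measure (N x) B \<le> measure (N x) (cylinder m [])"
        using bounded_measure[of B] sets_eq_imp_space_eq[OF N(2)[of x]] by (simp add: cylinder_Nil)
      also have "\<dots> = (norm x)\<^sup>2"
        by (simp add: N_cyl Nil power2_norm_eq_inner)
      finally show ?thesis .
    qed
    have "(s B x y)\<^sup>2 \<le> s B x x * s B y y"
      by (rule Cauchy_Schwarz_form[OF s_sym[OF B] s_add[OF B] s_scale[OF B]])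
        (simp add: s_self[OF B])
    also have "\<dots> \<le> (norm x)\<^sup>2 * (norm y)\<^sup>2"
      unfolding s_self[OF B] by (intro mult_mono mass) simp_all
    also have "\<dots> = (norm y * norm x)\<^sup>2"
      by (simp add: power_mult_distrib mult.commute)
    finally show ?thesis
      by (simp add: abs_le_square_iff[symmetric])
  qed
  have "\<exists>u. \<forall>x. inner u x = s B x y" if B: "B \<in> sets (Omega m)" for B y
  proof (rule riesz_on_subspace[where f = "\<lambda>x. s B x y", OF subspace_UNIV s_add[OF B] s_scale[OF B]
        s_le[OF B]])
    fix u assume "\<And>x. x \<in> UNIV \<Longrightarrow> inner u x = s B x y"
    then show "\<exists>u. \<forall>x. inner u x = s B x y" by (intro exI[of _ u]) simp
  qed
  then have "\<forall>B y. \<exists>u. B \<in> sets (Omega m) \<longrightarrow> (\<forall>x. inner u x = s B x y)" by simp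
  then obtain T where "\<And>B x y. B \<in> sets (Omega m) \<Longrightarrow> inner (T B y) x = s B x y"
    by metis
  then have T: "inner x (T B y) = s B x y" if "B \<in> sets (Omega m)" for B x y
    using that by (simp add: inner_commute)
  have T_pos: "T B \<in> positive_ops UNIV" if B: "B \<in> sets (Omega m)" for B
    unfolding positive_ops_UNIV_iff
  proof (intro conjI allI)
    have sym: "s B x y = s B y x" for x y by (rule s_sym[OF B])
    show "bounded_linear (T B)"
    proof (rule bounded_linear_intro[where K = 1])
      show "T B (x + y) = T B x + T B y" for x y
        by (rule vector_eq_ldot[THEN iffD1])
          (simp add: inner_add_right T[OF B] sym[of _ "x + y"] sym[of _ x] sym[of _ y] s_add[OF B])
      show "T B (r *\<^sub>R x) = r *\<^sub>R T B x" for r x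
        by (rule vector_eq_ldot[THEN iffD1])
          (simp add: T[OF B] sym[of _ "r *\<^sub>R x"] sym[of _ x] s_scale[OF B])
      fix x
      have "norm (T B x) * norm (T B x) = s B (T B x) x"
        by (simp add: T[OF B, symmetric] dot_square_norm power2_eq_square)
      also have "\<dots> \<le> norm x * norm (T B x)"
        using s_le[OF B, of "T B x" x] by simp
      finally show "norm (T B x) \<le> norm x * 1"
        by (cases "T B x = 0") (auto simp: mult_le_cancel_right)
    qed
    show "T B (\<i> *\<^sub>C x) = \<i> *\<^sub>C T B x" for x
    proof (rule vector_eq_ldot[THEN iffD1], rule allI)
      fix y
      have "inner y (\<i> *\<^sub>C T B x) = - inner (\<i> *\<^sub>C y) (T B x)"
        by (simp add: inner_i_scaleC_left)
      also have "\<dots> = inner y (T B (\<i> *\<^sub>C x))"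
        by (simp add: T[OF B] s_i[OF B])
      finally show "inner y (T B (\<i> *\<^sub>C x)) = inner y (\<i> *\<^sub>C T B x)" by simp
    qed
    show "inner x (T B y) = inner (T B x) y" for x y
      using sym[of x y] by (simp add: T[OF B] inner_commute[of "T B x"])
    show "0 \<le> inner x (T B x)" for x
      by (simp add: T[OF B] s_self[OF B])
  qed
  have T_cyl: "T (cylinder m w) = F w" if "w \<in> lists {..<m}" for w
  proof
    show "T (cylinder m w) y = F w y" for y
      by (rule vector_eq_ldot[THEN iffD1]) (simp add: T[OF cylinder_in_sets] s_cyl[OF that])
  qed
  show thesis
  proof (rule that[of "restrict T (sets (Omega m))"])
    show "restrict T (sets (Omega m)) (cylinder m w) = F w" if "w \<in> lists {..<m}" for w
      by (simp add: cylinder_in_sets T_cyl[OF that])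
    show "povm (Omega m) (restrict T (sets (Omega m)))"
      unfolding povm_def
    proof (intro conjI allI impI)
      show "restrict T (sets (Omega m)) \<in> sets (Omega m) \<rightarrow>\<^sub>E positive_ops UNIV"
        using T_pos by simp
      show "restrict T (sets (Omega m)) (space (Omega m)) = id"
        using T_cyl[of "[]"] by (simp add: cylinder_Nil Nil)
      fix B :: "nat \<Rightarrow> (nat \<Rightarrow> nat) set" and x y
      assume B: "range B \<subseteq> sets (Omega m)" "disjoint_family B"
      have Bn: "B n \<in> sets (Omega m)" for n using B(1) by auto
      have Un: "(\<Union>n. B n) \<in> sets (Omega m)" by (rule sets.countable_UN[OF B(1)])
      have "(\<lambda>n. cinner x (T (B n) y)) sums cinner x (T (\<Union>n. B n) y)"
        using sigma_additiveD[OF sa B]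
        by (simp add: sums_complex_iff inner_eq_Re_cinner[symmetric] Im_cinner T[OF Bn] T[OF Un])
      then show "(\<lambda>n. cinner x (restrict T (sets (Omega m)) (B n) y)) sums
          cinner x (restrict T (sets (Omega m)) (\<Union>n. B n) y)"
        by (simp only: restrict_apply Bn Un if_True)
    qed
  qed
qed

theorem theorem2p6:
  fixes m :: nat
  assumes "m \<ge> 2"
  shows "(\<forall>E :: (nat \<Rightarrow> nat) set \<Rightarrow> 'h::complex_hilbert \<Rightarrow> 'h. povm (Omega m) E \<longrightarrow>
      (\<forall>w \<in> lists {..<m}.
        let Ew = (\<lambda>w. E (cylinder m w)); Hw = support_space (Ew w) in
        \<exists>!A. A \<in> {..<m} \<rightarrow>\<^sub>E positive_contractions Hw \<and>
          (\<forall>x\<in>Hw. (\<Sum>j<m. A j x) = x) \<and>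
          (\<forall>j<m. Ew (w @ [j]) = op_sqrt (Ew w) \<circ> zero_ext Hw (A j) \<circ> op_sqrt (Ew w))))
    \<and>
    (\<forall>(Ew :: nat list \<Rightarrow> 'h \<Rightarrow> 'h) (A :: nat list \<Rightarrow> nat \<Rightarrow> 'h \<Rightarrow> 'h).
      Ew [] = id \<longrightarrow>
      (\<forall>w \<in> lists {..<m}.
        let Hw = support_space (Ew w) in
          (\<forall>j<m. A w j \<in> positive_contractions Hw) \<and>
          (\<forall>x\<in>Hw. (\<Sum>j<m. A w j x) = x) \<and>
          (\<forall>j<m. Ew (w @ [j]) = op_sqrt (Ew w) \<circ> zero_ext Hw (A w j) \<circ> op_sqrt (Ew w))) \<longrightarrow>
      (\<exists>!E. povm (Omega m) E \<and> (\<forall>w \<in> lists {..<m}. E (cylinder m w) = Ew w)))"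
proof (intro conjI allI impI ballI)
  fix E :: "(nat \<Rightarrow> nat) set \<Rightarrow> 'h \<Rightarrow> 'h" and w
  assume E: "povm (Omega m) E" and "w \<in> lists {..<m}"
  show "let Ew = (\<lambda>w. E (cylinder m w)); Hw = support_space (Ew w) in
        \<exists>!A. A \<in> {..<m} \<rightarrow>\<^sub>E positive_contractions Hw \<and>
          (\<forall>x\<in>Hw. (\<Sum>j<m. A j x) = x) \<and>
          (\<forall>j<m. Ew (w @ [j]) = op_sqrt (Ew w) \<circ> zero_ext Hw (A j) \<circ> op_sqrt (Ew w))"
    unfolding Let_def
    by (rule operator_derivatives_unique_existence)
      (auto intro: povm_positive_op[OF E] cylinder_in_sets povm_sum_cylinder_snoc[OF E])
next
  fix Ew :: "nat list \<Rightarrow> 'h \<Rightarrow> 'h" and A :: "nat list \<Rightarrow> nat \<Rightarrow> 'h \<Rightarrow> 'h"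
  assume Nil: "Ew [] = id" and
    "\<forall>w \<in> lists {..<m}.
        let Hw = support_space (Ew w) in
          (\<forall>j<m. A w j \<in> positive_contractions Hw) \<and>
          (\<forall>x\<in>Hw. (\<Sum>j<m. A w j x) = x) \<and>
          (\<forall>j<m. Ew (w @ [j]) = op_sqrt (Ew w) \<circ> zero_ext Hw (A w j) \<circ> op_sqrt (Ew w))"
  then have A: "\<And>w j. w \<in> lists {..<m} \<Longrightarrow> j < m \<Longrightarrow> A w j \<in> positive_ops (support_space (Ew w))"
    and sum: "\<And>w x. w \<in> lists {..<m} \<Longrightarrow> x \<in> support_space (Ew w) \<Longrightarrow> (\<Sum>j<m. A w j x) = x"
    and snoc: "\<And>w j. w \<in> lists {..<m} \<Longrightarrow> j < m \<Longrightarrow> Ew (w @ [j]) =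
      op_sqrt (Ew w) \<circ> zero_ext (support_space (Ew w)) (A w j) \<circ> op_sqrt (Ew w)"
    unfolding Let_def positive_contractions_def by blast+
  have pos: "Ew w \<in> positive_ops UNIV" if "w \<in> lists {..<m}" for w
    using that
  proof (induction w rule: rev_induct)
    case Nil
    show ?case by (simp only: \<open>Ew [] = id\<close> id_positive_op)
  next
    case (snoc j w)
    then have w: "w \<in> lists {..<m}" and j: "j < m" by auto
    show ?case
      unfolding \<open>\<And>w j. w \<in> lists {..<m} \<Longrightarrow> j < m \<Longrightarrow> Ew (w @ [j]) = _\<close>[OF w j]
      by (rule positive_op_compression[OF snoc.IH[OF w] A[OF w j]])
  qed
  have "(\<Sum>j<m. Ew (w @ [j]) x) = Ew w x" if w: "w \<in> lists {..<m}" for w x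
    using sum_compressions[OF pos[OF w] sum[OF w]] by (simp add: snoc[OF w])
  then obtain E where E: "povm (Omega m) E" "\<And>w. w \<in> lists {..<m} \<Longrightarrow> E (cylinder m w) = Ew w"
    using povm_with_cylinder_values_exists[of m Ew, OF pos Nil] by blast
  show "\<exists>!E. povm (Omega m) E \<and> (\<forall>w \<in> lists {..<m}. E (cylinder m w) = Ew w)"
  proof (rule ex1I)
    show "povm (Omega m) E \<and> (\<forall>w \<in> lists {..<m}. E (cylinder m w) = Ew w)"
      using E by simp
    fix E'
    assume "povm (Omega m) E' \<and> (\<forall>w \<in> lists {..<m}. E' (cylinder m w) = Ew w)"
    then have "povm (Omega m) E'" and E': "\<And>w. w \<in> lists {..<m} \<Longrightarrow> E' (cylinder m w) = Ew w"
      by blast+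
    then show "E' = E"
      by (intro povm_unique[OF _ E(1)]) (simp_all only: E(2) E')
  qed
qed

end
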